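(* Let $X_1,X_2,\ldots$ be independent copies of a random variable $X$ with cumulative distribution function $F$, where $F(0)=0$ and $F(x)<1$ for all $x\ge 0$, and let $R_1,R_2,\ldots$ be the corresponding sequence of (upper) record values. Let $H(x)=-\ln(1-F(x))$ for $x\ge 0$ and $h(x)=H'(x)$. Suppose $F(x)$ satisfies the following conditions. (i) $F(x)$ is absolutely continuous in $[0,\infty)$ and $F''(x)$ is continuous in $(0,\infty)$; (ii) $h(x)$ is nowhere constant in a small interval $(0,\varepsilon)$ for $\varepsilon>0$. Assume that $g(x)$ is continuous in $[0,\infty)$, $g'(x)$ is continuous in $(0,\infty)$, and $g'(0+)\ne 0$. Let $n\ge 2$ be an integer. For $0\le u<v$ put $$\bar g(u,v)=\frac{1}{v-u}\int_u^v g(t)\,dt,\qquad I_n(u,v)=\int_0^1 g(u+(v-u)z)\,z^{n-1}\,dz.$$ Then $F$ is the exponential distribution function $F(x)=1-e^{-cx}$ $(x\ge 0)$, where $c>0$, if and only if for $0\le u<v<\infty$ $$E\left[\frac{g(R_2)+g(R_3)+\cdots+g(R_n)}{n-1}\,\Big|\, R_1=u,\ R_{n+2}=v\right]=\bar g(u,v)-\frac{nI_n(u,v)-\bar g(u,v)}{n-1}.$$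
   Context: Record times and record values: $T_1=1$ and $T_n=\min\{j: X_j>X_{T_{n-1}},\ j>T_{n-1}\}$ for $n>1$; the record values are $R_n=X_{T_n}$, $n=1,2,\ldots$. $H$ is the cumulative hazard function of $X$ and $h$ is its hazard (failure) rate. $g'(0+)$ denotes $\lim_{x\to 0+}g'(x)$. For $2\le j\le n$ and $u<t<v$, the conditional density of $R_j$ given $R_1=u$, $R_{n+2}=v$ is $$f_{j|1,n+2}(t|u,v)=\frac{n!}{(j-2)!\,(n+1-j)!}\left[\frac{H(t)-H(u)}{H(v)-H(u)}\right]^{j-2}\left[\frac{H(v)-H(t)}{H(v)-H(u)}\right]^{n+1-j}\frac{h(t)}{H(v)-H(u)},$$ and the conditional expectation of $g(R_2)+\cdots+g(R_n)$ given $R_1=u$, $R_{n+2}=v$ is $\int_u^v g(t)\sum_{j=2}^n f_{j|1,n+2}(t|u,v)\,dt$. *)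

theory Defs
  imports "HOL-Probability.Probability"
begin

text \<open>Sequences and record numbers are indexed from 1, so the values at index 0 are irrelevant.
  If there is no further record, the previous record time is repeated. For independent copies
  of a random variable with \<open>F x < 1\<close> everywhere this has probability 0, and the convention
  keeps the records measurable without any condition on the unused term with index 0.\<close>

primrec record_time :: "(nat \<Rightarrow> real) \<Rightarrow> nat \<Rightarrow> nat" where
  "record_time x 0 = 0"
| "record_time x (Suc n) =
     (if n = 0 then 1
      else if \<exists>j > record_time x n. x j > x (record_time x n)
      then LEAST j. x j > x (record_time x n) \<and> j > record_time x n
      else record_time x n)"

definition record_value :: "(nat \<Rightarrow> real) \<Rightarrow> nat \<Rightarrow> real" where
  "record_value x n = x (record_time x n)"

definition cum_hazard :: "(real \<Rightarrow> real) \<Rightarrow> real \<Rightarrow> real" where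
  "cum_hazard F x = - ln (1 - F x)"

definition hazard_rate :: "(real \<Rightarrow> real) \<Rightarrow> real \<Rightarrow> real" where
  "hazard_rate F = deriv (cum_hazard F)"

text \<open>Absolute continuity of a function on an interval; the library only has absolute
  continuity of measures. The elements of \<open>D\<close> are the pairs of endpoints of
  non-overlapping subintervals.\<close>

definition abs_continuous_on :: "real set \<Rightarrow> (real \<Rightarrow> real) \<Rightarrow> bool" where
  "abs_continuous_on S f \<longleftrightarrow>
     (\<forall>\<epsilon>>0. \<exists>\<delta>>0. \<forall>D. finite D \<and> (\<forall>(a, b)\<in>D. a \<le> b \<and> {a..b} \<subseteq> S) \<and>
        pairwise (\<lambda>(a, b) (c, d). {a<..<b} \<inter> {c<..<d} = {}) D \<and>
        (\<Sum>(a, b)\<in>D. b - a) < \<delta> \<longrightarrow> (\<Sum>(a, b)\<in>D. \<bar>f b - f a\<bar>) < \<epsilon>)"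

text \<open>A hazard rate that is nowhere constant near 0 excludes the exponential distributions,
  whose hazard rate is constant on \<open>(0, \<infinity>)\<close>. As a hypothesis of a characterization of
  these distributions, nowhere constancy near 0 is therefore read as an alternative to constancy
  on all of \<open>(0, \<infinity>)\<close>. This is weaker than nowhere constancy near 0 alone, so it yields a
  stronger theorem.\<close>

definition nowhere_constant_on :: "(real \<Rightarrow> real) \<Rightarrow> real set \<Rightarrow> bool" where
  "nowhere_constant_on f S \<longleftrightarrow>
     (\<forall>a b. a < b \<and> {a<..<b} \<subseteq> S \<longrightarrow> \<not> f constant_on {a<..<b})"

text \<open>\<open>cond_exp_given M Z W e\<close>: the function \<open>e\<close> is a version of
  \<open>w \<mapsto> E[Z | W = w]\<close>, i.e. \<open>e\<close> is Borel and \<open>e \<circ> W\<close> is the conditional expectation of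
  \<open>Z\<close> with respect to the sigma-algebra generated by \<open>W\<close>. No integrability of \<open>Z\<close> is
  imposed: \<^const>\<open>real_cond_exp\<close> is the difference of the conditional expectations of the
  positive and the negative part, which are finite almost surely when \<open>\<bar>Z\<bar>\<close> is bounded by a
  function of \<open>W\<close>, as it is below, where \<open>W\<close> consists of two records enclosing
  those that \<open>Z\<close> depends on.\<close>

definition cond_exp_given ::
    "'a measure \<Rightarrow> ('a \<Rightarrow> real) \<Rightarrow> ('a \<Rightarrow> 'b::topological_space) \<Rightarrow> ('b \<Rightarrow> real) \<Rightarrow> bool" where
  "cond_exp_given M Z W e \<longleftrightarrow> e \<in> borel_measurable borel \<and>
     (AE \<omega> in M. real_cond_exp M (vimage_algebra (space M) W borel) Z \<omega> = e (W \<omega>))"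

text \<open>The indicator discards the values of \<open>g\<close> at negative arguments, where nothing is assumed
  about \<open>g\<close>, not even measurability; records of an almost surely positive sequence are
  negative only on a null set.\<close>

definition record_mean :: "(real \<Rightarrow> real) \<Rightarrow> nat \<Rightarrow> (nat \<Rightarrow> real) \<Rightarrow> real" where
  "record_mean g n x =
     (\<Sum>j = 2..n. indicator {0..} (record_value x j) * g (record_value x j)) / (real n - 1)"

definition gbar :: "(real \<Rightarrow> real) \<Rightarrow> real \<Rightarrow> real \<Rightarrow> real" where
  "gbar g u v = 1 / (v - u) * integral {u..v} g"

definition I_avg :: "(real \<Rightarrow> real) \<Rightarrow> nat \<Rightarrow> real \<Rightarrow> real \<Rightarrow> real" where
  "I_avg g n u v = integral {0..1} (\<lambda>z. g (u + (v - u) * z) * z ^ (n - 1))"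

end

theory Submission
  imports Defs
begin

text \<open>Write \<open>H\<close> for the cumulative hazard and \<open>h\<close> for its derivative. The records of an i.i.d. sequence
  form a Markov chain: from \<open>r\<close> the next record is drawn from the law of \<open>X\<close> conditioned on \<open>(r, \<infinity>)\<close>.
  In terms of the measure \<open>h(t) dt\<close> the joint density of successive records is, up to the
  factor \<open>1 - F\<close> at the last one, the indicator of an increasing chain, so that the \<open>n\<close> records strictly between
  \<open>R\<^sub>1 = u\<close> and \<open>R\<^sub>n\<^sub>+\<^sub>2 = v\<close> are distributed, on the scale \<open>w = (H(t) - H(u)) / (H(v) - H(u))\<close>,
  like the order statistics of \<open>n\<close> independent uniform variables. Leaving out the largest of
  them, the binomial theorem gives
  \<open>E[g(R\<^sub>2) + \<dots> + g(R\<^sub>n) | R\<^sub>1 = u, R\<^sub>n\<^sub>+\<^sub>2 = v] = \<integral> g n (1 - w\<^sup>n\<^sup>-\<^sup>1) dw\<close>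
  (theorems \<open>nn_integral_next_record\<close>, \<open>nn_integral_later_record\<close>, \<open>nn_integral_inner_records\<close> and,
  for the conditional expectation, \<open>real_cond_exp_inner_records\<close>).

  For an exponential law \<open>H\<close> is linear, \<open>w\<close> is the affine parameter \<open>(t - u) / (v - u)\<close>, and the
  right hand side is the one of the theorem (lemma \<open>uniform_mean\<close>).

  For the converse the identity is needed at a single well chosen pair \<open>u < v\<close>. If \<open>h\<close> is
  nowhere constant near 0, there is an interval \<open>[a, b]\<close> near 0 on which \<open>h\<close> is positive and injective and
  on which \<open>g'\<close> has no zero. The two outer records fall into it with positive probability, so some
  \<open>a < u < v < b\<close> satisfy the identity, that is, \<open>g\<close> has the same integral against \<open>dP(w)\<close> for the
  parameter \<open>w\<close> belonging to \<open>H\<close> and for the affine parameter, where \<open>P(w) = n w - w\<^sup>n\<close>. With \<open>D\<close> the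
  difference of the two functions \<open>P(w)\<close>, integration by parts and Rolle's theorem produce a point in
  \<open>(u, v)\<close> at which \<open>g' D = 0\<close>. There \<open>D = 0\<close>, hence the two parameters agree because \<open>P\<close> is injective on
  \<open>[0, 1]\<close>, hence \<open>H\<close> has the same slope to the left and to the right of that point, which
  contradicts injectivity of \<open>h\<close> (lemmas \<open>kernel_means_differ\<close> and \<open>outer_records_hit\<close>). If instead
  \<open>h\<close> is constant on \<open>(0, \<infinity>)\<close>, the law is exponential by the mean value theorem.\<close>

section \<open>Records of a deterministic sequence\<close>

text \<open>\<^const>\<open>record_time\<close> depends on the whole future of the sequence, since it looks for a next record.
  The event \<open>record_at x m k\<close> that the \<open>m\<close>-th record occurs at time \<open>k\<close>, with all records before it
  genuine, is determined by the terms up to time \<open>k\<close> (lemma \<open>record_at_cong\<close>), which is what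
  independence can be applied to.\<close>

primrec record_at :: "(nat \<Rightarrow> real) \<Rightarrow> nat \<Rightarrow> nat \<Rightarrow> bool" where
  "record_at x 0 k \<longleftrightarrow> False"
| "record_at x (Suc m) k \<longleftrightarrow>
     (if m = 0 then k = 1
      else \<exists>j\<in>{1..<k}. record_at x m j \<and> x j < x k \<and> (\<forall>i\<in>{j<..<k}. x i \<le> x j))"

text \<open>Truncation by zeros keeps all pasts in one measurable space, whatever the time.\<close>

definition past :: "nat \<Rightarrow> (nat \<Rightarrow> real) \<Rightarrow> nat \<Rightarrow> real" where
  "past k x i = (if i \<in> {1..k} then x i else 0)"

definition record_history :: "nat \<Rightarrow> (nat \<Rightarrow> real) \<Rightarrow> nat \<Rightarrow> real" where
  "record_history m x i = (if i \<in> {1..m} then record_value x i else 0)"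

declare record_at.simps(2)[simp del]

lemma record_at_1[simp]: "record_at x (Suc 0) k \<longleftrightarrow> k = 1"
  by (simp add: record_at.simps)

lemma record_at_pos: "record_at x m k \<Longrightarrow> 1 \<le> k"
  by (cases m) (auto simp: record_at.simps split: if_splits)

lemma record_time_eq: "record_at x m k \<Longrightarrow> record_time x m = k"
proof (induction m arbitrary: k)
  case (Suc m)
  show ?case
  proof (cases "m = 0")
    case False
    then obtain j where j: "j < k" "record_at x m j" "x j < x k" "\<forall>i\<in>{j<..<k}. x i \<le> x j"
      using Suc.prems by (auto simp: record_at.simps)
    have "(LEAST i. x i > x j \<and> i > j) = k"
    proof (rule Least_equality)
      fix i assume "x i > x j \<and> i > j"
      then show "k \<le> i" using j(4) by (meson greaterThanLessThan_iff leD leI)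
    qed (use j in auto)
    moreover have "\<exists>i>j. x i > x j" using j by auto
    ultimately show ?thesis using Suc.IH[OF j(2)] False by simp
  qed (use Suc.prems in simp)
qed simp

lemma record_at_unique: "record_at x m k \<Longrightarrow> record_at x m k' \<Longrightarrow> k = k'"
  using record_time_eq by metis

lemma record_at_cong:
  "(\<And>i. i \<in> {1..k} \<Longrightarrow> x i = y i) \<Longrightarrow> record_at x m k \<longleftrightarrow> record_at y m k"
proof (induction m arbitrary: k)
  case (Suc m)
  have "(\<exists>j\<in>{1..<k}. record_at x m j \<and> x j < x k \<and> (\<forall>i\<in>{j<..<k}. x i \<le> x j)) \<longleftrightarrow>
        (\<exists>j\<in>{1..<k}. record_at y m j \<and> y j < y k \<and> (\<forall>i\<in>{j<..<k}. y i \<le> y j))"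
  proof (rule bex_cong[OF refl])
    fix j assume "j \<in> {1..<k}"
    then show "(record_at x m j \<and> x j < x k \<and> (\<forall>i\<in>{j<..<k}. x i \<le> x j)) \<longleftrightarrow>
        (record_at y m j \<and> y j < y k \<and> (\<forall>i\<in>{j<..<k}. y i \<le> y j))"
      using Suc.prems Suc.IH[of j] by auto
  qed
  then show ?case by (simp add: record_at.simps)
qed simp

lemma record_at_earlier: "record_at x m k \<Longrightarrow> i \<in> {1..m} \<Longrightarrow> \<exists>j\<le>k. record_at x i j"
proof (induction m arbitrary: k)
  case (Suc m)
  show ?case
  proof (cases "i = Suc m")
    case False
    then have i: "i \<in> {1..m}" using Suc.prems by auto
    then obtain j where "j < k" "record_at x m j" using Suc.prems by (auto simp: record_at.simps)
    from Suc.IH[OF this(2) i] \<open>j < k\<close> show ?thesis by (meson le_trans less_imp_le)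
  qed (use Suc.prems in blast)
qed simp

text \<open>On the event that the \<open>m\<close>-th record occurs at time \<open>k\<close>, all records so far are functions of the
  first \<open>k\<close> terms; this makes the record history independent of the later terms.\<close>

lemma record_history_past:
  assumes "record_at x m k"
  shows "record_history m (past k x) = record_history m x"
proof
  fix i
  show "record_history m (past k x) i = record_history m x i"
  proof (cases "i \<in> {1..m}")
    case True
    then obtain j where j: "j \<le> k" "record_at x i j" using record_at_earlier[OF assms] by auto
    have "record_at (past k x) i j"
      using j by (subst record_at_cong[of _ _ x]) (auto simp: past_def)
    then show ?thesis
      using j record_at_pos[OF j(2)]
      by (auto simp: record_history_def record_value_def record_time_eq past_def)
  next
    case False
    then show ?thesis by (simp only: record_history_def if_False)
  qed
qed

lemma record_at_last:
  assumes "record_at x m k" shows "record_value x m = x k" "1 \<le> m"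
proof -
  show "1 \<le> m" using assms by (cases m) auto
  show "record_value x m = x k"
    using assms by (simp add: record_value_def record_time_eq)
qed

definition stays_below :: "(nat \<Rightarrow> real) \<Rightarrow> nat \<Rightarrow> nat \<Rightarrow> bool" where
  "stays_below x k l \<longleftrightarrow> (\<forall>i\<in>{k<..k+l}. x i \<le> x k)"

definition next_at :: "(nat \<Rightarrow> real) \<Rightarrow> nat \<Rightarrow> nat \<Rightarrow> bool" where
  "next_at x k l \<longleftrightarrow> stays_below x k l \<and> x k < x (Suc (k + l))"

text \<open>The waiting time after a record decomposes the event of a further record into the disjoint
  events \<open>next_at x k l\<close>.\<close>

lemma record_at_Suc_iff:
  assumes "record_at x m k"
  shows "record_at x (Suc m) k' \<longleftrightarrow> (\<exists>l. k' = Suc (k + l) \<and> next_at x k l)"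
proof -
  have "m \<noteq> 0" using record_at_last(2)[OF assms] by simp
  have "record_at x (Suc m) k' \<longleftrightarrow> k < k' \<and> x k < x k' \<and> (\<forall>i\<in>{k<..<k'}. x i \<le> x k)"
    (is "_ \<longleftrightarrow> ?R")
  proof -
    have "record_at x (Suc m) k' \<longleftrightarrow>
        (\<exists>j\<in>{1..<k'}. record_at x m j \<and> x j < x k' \<and> (\<forall>i\<in>{j<..<k'}. x i \<le> x j))"
      using \<open>m \<noteq> 0\<close> by (simp add: record_at.simps)
    also have "\<dots> \<longleftrightarrow> ?R"
    proof
      assume ?R
      then show "\<exists>j\<in>{1..<k'}. record_at x m j \<and> x j < x k' \<and> (\<forall>i\<in>{j<..<k'}. x i \<le> x j)"
        using assms record_at_pos[OF assms] by (intro bexI[of _ k]) auto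
    qed (use record_at_unique[OF assms] in auto)
    finally show ?thesis .
  qed
  also have "\<dots> \<longleftrightarrow> (\<exists>l. k' = Suc (k + l) \<and> next_at x k l)"
  proof
    assume k': "k < k' \<and> x k < x k' \<and> (\<forall>i\<in>{k<..<k'}. x i \<le> x k)"
    then obtain l where "k' = Suc (k + l)" using less_imp_Suc_add by blast
    with k' show "\<exists>l. k' = Suc (k + l) \<and> next_at x k l" by (auto simp: next_at_def stays_below_def)
  qed (auto simp: next_at_def stays_below_def)
  finally show ?thesis .
qed

lemma next_at_unique:
  assumes "next_at x k l" "next_at x k l'"
  shows "l = l'"
proof -
  have "\<not> a < b" if "next_at x k a" "next_at x k b" for a b
  proof
    assume "a < b"
    then have "Suc (k + a) \<in> {k<..k+b}" by simp
    then show False using that unfolding next_at_def stays_below_def by fastforce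
  qed
  from this[OF assms] this[OF assms(2,1)] show ?thesis by simp
qed

lemma record_value_mono: "1 \<le> m \<Longrightarrow> record_value x m \<le> record_value x (Suc m)"
proof -
  assume "1 \<le> m"
  moreover have "x (record_time x m) < x (LEAST j. x j > x (record_time x m) \<and> j > record_time x m)"
    if "\<exists>j>record_time x m. x j > x (record_time x m)"
    using LeastI_ex[of "\<lambda>j. x j > x (record_time x m) \<and> j > record_time x m"] that by blast
  ultimately show ?thesis unfolding record_value_def record_time.simps by (simp add: less_imp_le del: not_ex not_all)
qed

lemma record_value_mono_le: "1 \<le> i \<Longrightarrow> i \<le> j \<Longrightarrow> record_value x i \<le> record_value x j"
proof (rotate_tac, induction j rule: dec_induct)
  case (step j)
  then show ?case using record_value_mono[of j x] by simp
qed simp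

lemma record_time_pos: "1 \<le> m \<Longrightarrow> 1 \<le> record_time x m"
proof (induction m rule: dec_induct)
  case (step m)
  have "1 \<le> (LEAST j. x j > x (record_time x m) \<and> j > record_time x m)"
    if "\<exists>j>record_time x m. x j > x (record_time x m)"
    using LeastI_ex[of "\<lambda>j. x j > x (record_time x m) \<and> j > record_time x m"] that by fastforce
  then show ?case using step by auto
qed simp

lemma record_value_cong:
  assumes "\<And>i. 1 \<le> i \<Longrightarrow> x i = y i" "1 \<le> m"
  shows "record_value x m = record_value y m"
proof -
  have "record_time x m = record_time y m" using assms(2)
  proof (induction m rule: dec_induct)
    case (step m)
    define r where "r = record_time y m"
    have r: "record_time x m = r" "1 \<le> r" using step record_time_pos by (auto simp: r_def)
    have "(x r < x j \<and> r < j) = (y r < y j \<and> r < j)" for j using assms(1) r(2) by (cases "r<j") auto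
    then have "(\<lambda>j. x r < x j \<and> r < j) = (\<lambda>j. y r < y j \<and> r < j)"
       "(\<exists>j>r. x j > x r) \<longleftrightarrow> (\<exists>j>r. y j > y r)" by (blast, metis)
    then show ?case using step.hyps unfolding record_time.simps r(1) r_def[symmetric] by presburger
  qed simp
  then show ?thesis using assms record_time_pos[OF assms(2)] by (simp add: record_value_def)
qed

abbreviation seqs :: "(nat \<Rightarrow> real) measure" where
  "seqs \<equiv> Pi\<^sub>M UNIV (\<lambda>_. borel)"

lemma measurable_coord[measurable]: "(\<lambda>x. x i) \<in> borel_measurable seqs"
  by (rule measurable_component_singleton) simp

lemma measurable_coord_le[measurable]: "Measurable.pred seqs (\<lambda>x. x i \<le> x j)"
  by (simp only: not_less[symmetric]) (intro pred_intros_logic borel_measurable_pred_less measurable_coord)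

lemma measurable_record_time[measurable]: "(\<lambda>x. record_time x m) \<in> seqs \<rightarrow>\<^sub>M count_space UNIV"
proof (induction m)
  case (Suc m)
  note [measurable] = Suc
  have [measurable]: "(\<lambda>x. x (record_time x m)) \<in> borel_measurable seqs"
    by (rule measurable_compose_countable[OF _ Suc]) measurable
  show ?case unfolding record_time.simps by measurable
qed simp

lemma measurable_record_value[measurable]: "(\<lambda>x. record_value x m) \<in> borel_measurable seqs"
  unfolding record_value_def
  by (rule measurable_compose_countable[OF _ measurable_record_time]) measurable

lemma measurable_record_at[measurable]: "Measurable.pred seqs (\<lambda>x. record_at x m k)"
proof (induction m arbitrary: k)
  case (Suc m)
  note [measurable] = Suc
  show ?case
  proof (cases "m = 0")
    case False
    have "Measurable.pred seqs (\<lambda>x. \<exists>j\<in>{1..<k}. record_at x m j \<and> x j < x k \<and> (\<forall>i\<in>{j<..<k}. x i \<le> x j))"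
      by (intro pred_intros_finite pred_intros_logic finite_atLeastLessThan finite_greaterThanLessThan Suc
            borel_measurable_pred_less measurable_coord_le measurable_coord)
    then show ?thesis using False by (simp add: record_at.simps)
  qed simp
qed simp

lemma measurable_past[measurable]: "past k \<in> seqs \<rightarrow>\<^sub>M seqs"
  unfolding past_def[abs_def] by (rule measurable_PiM_single') auto

lemma measurable_record_history[measurable]: "record_history m \<in> seqs \<rightarrow>\<^sub>M seqs"
  unfolding record_history_def[abs_def] by (rule measurable_PiM_single') auto

lemma measurable_stays_below[measurable]: "Measurable.pred seqs (\<lambda>x. stays_below x k l)"
  unfolding stays_below_def
  by (intro pred_intros_finite finite_greaterThanAtMost measurable_coord_le)

lemma measurable_next_at[measurable]: "Measurable.pred seqs (\<lambda>x. next_at x k l)"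
  unfolding next_at_def
  by (intro pred_intros_logic measurable_stays_below borel_measurable_pred_less measurable_coord)

section \<open>The Markov property of records\<close>

lemma suminf_single:
  fixes f :: "nat \<Rightarrow> ennreal"
  assumes "P k" "\<And>k'. P k' \<Longrightarrow> k' = k"
  shows "(\<Sum>k. if P k then f k else 0) = f k"
proof -
  have "(\<Sum>k. if P k then f k else 0) = (\<Sum>k\<in>{k}. if P k then f k else 0)"
    by (rule suminf_finite) (use assms(2) in auto)
  then show ?thesis using assms(1) by simp
qed

lemma past_past: "k \<le> k' \<Longrightarrow> past k (past k' x) = past k x"
  by (auto simp: past_def)

lemma past_last: "1 \<le> k \<Longrightarrow> k \<le> k' \<Longrightarrow> past k' x k = x k"
  by (simp add: past_def)

lemma stays_below_past: "1 \<le> k \<Longrightarrow> stays_below (past (k + l) x) k l \<longleftrightarrow> stays_below x k l"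
  by (auto simp: stays_below_def past_def)

lemma stays_below_Suc:
  "stays_below x k (Suc l) \<longleftrightarrow> stays_below x k l \<and> x (Suc (k + l)) \<le> x k"
  by (auto simp: stays_below_def le_Suc_eq)

lemma stays_below_0: "stays_below x k 0"
  by (simp add: stays_below_def)

text \<open>Every level is exceeded with positive probability, so that there is always a next record and
  conditioning on \<open>X > r\<close> makes sense for every \<open>r\<close>.\<close>

locale iid_sequence = prob_space M for M :: "'a measure" +
  fixes X :: "nat \<Rightarrow> 'a \<Rightarrow> real" and \<mu> :: "real measure"
  assumes X_measurable[measurable]: "\<And>i. X i \<in> borel_measurable M"
    and X_indep: "indep_vars (\<lambda>_. borel) X {1..}"
    and X_law: "\<And>i. 1 \<le> i \<Longrightarrow> distr M borel (X i) = \<mu>"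
    and exceeds: "\<And>x. emeasure \<mu> {x<..} \<noteq> 0"
begin

abbreviation path :: "'a \<Rightarrow> nat \<Rightarrow> real" where "path \<omega> \<equiv> \<lambda>i. X i \<omega>"

abbreviation R :: "nat \<Rightarrow> 'a \<Rightarrow> real" where "R m \<omega> \<equiv> record_value (path \<omega>) m"

lemma prob_space_law: "prob_space \<mu>"
  using prob_space_distr[OF X_measurable[of 1]] X_law[of 1] by simp

lemma sets_law[measurable_cong, simp]: "sets \<mu> = sets borel"
  using X_law[of 1] by auto

lemma space_law[simp]: "space \<mu> = UNIV"
  using X_law[of 1] by auto

lemma measurable_path[measurable]: "path \<in> M \<rightarrow>\<^sub>M seqs"
  by (rule measurable_PiM_single') auto

lemma measurable_R[measurable]: "R m \<in> borel_measurable M"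
  by (rule measurable_compose[OF measurable_path measurable_record_value])

text \<open>Independence of \<open>X\<^sub>k\<^sub>+\<^sub>1\<close> from the past, in the form in which it is used: the next term may be
  integrated out first.\<close>

lemma nn_integral_next:
  assumes [measurable]: "\<Psi> \<in> borel_measurable (seqs \<Otimes>\<^sub>M borel)"
  shows "(\<integral>\<^sup>+\<omega>. \<Psi> (past k (path \<omega>), X (Suc k) \<omega>) \<partial>M) =
    (\<integral>\<^sup>+\<omega>. \<integral>\<^sup>+y. \<Psi> (past k (path \<omega>), y) \<partial>\<mu> \<partial>M)"
proof -
  interpret law: prob_space \<mu> by (rule prob_space_law)
  define J where "J = {1..k}"
  let ?A = "\<lambda>\<omega>. restrict (path \<omega>) J" and ?B = "\<lambda>\<omega>. restrict (path \<omega>) {Suc k}"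
  let ?PA = "PiM J (\<lambda>_. borel :: real measure)" and ?PB = "PiM {Suc k} (\<lambda>_. borel :: real measure)"
  \<comment> \<open>\<open>indep_var\<close> requires both variables to have the same type, so the next term is kept as a function on the singleton \<open>{Suc k}\<close>.\<close>
  define ext where "ext s i = (if i \<in> J then s i else 0)" for s :: "nat \<Rightarrow> real" and i
  have ext_past: "ext (?A \<omega>) = past k (path \<omega>)" for \<omega>
    by (auto simp: fun_eq_iff past_def ext_def J_def)
  have [measurable]: "ext \<in> ?PA \<rightarrow>\<^sub>M seqs"
  proof (rule measurable_PiM_single')
    fix i
    show "(\<lambda>s. ext s i) \<in> borel_measurable ?PA"
      by (cases "i \<in> J") (simp_all add: ext_def measurable_component_singleton)
  qed auto
  have [measurable]: "(\<lambda>t. t (Suc k)) \<in> borel_measurable ?PB"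
    by (rule measurable_component_singleton) simp
  have "indep_var ?PA ?A ?PB ?B"
    by (rule indep_var_restrict[OF X_indep]) (auto simp: J_def)
  then have [measurable]: "?A \<in> M \<rightarrow>\<^sub>M ?PA" "?B \<in> M \<rightarrow>\<^sub>M ?PB"
    and joint: "distr M (?PA \<Otimes>\<^sub>M ?PB) (\<lambda>\<omega>. (?A \<omega>, ?B \<omega>)) = distr M ?PA ?A \<Otimes>\<^sub>M distr M ?PB ?B"
    unfolding indep_var_distribution_eq by auto
  interpret B: prob_space "distr M ?PB ?B" by (rule prob_space_distr) measurable
  have "(\<integral>\<^sup>+\<omega>. \<Psi> (past k (path \<omega>), X (Suc k) \<omega>) \<partial>M) =
      (\<integral>\<^sup>+p. \<Psi> (ext (fst p), snd p (Suc k)) \<partial>distr M (?PA \<Otimes>\<^sub>M ?PB) (\<lambda>\<omega>. (?A \<omega>, ?B \<omega>)))"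
    by (subst nn_integral_distr) (auto simp: ext_past)
  also have "\<dots> = (\<integral>\<^sup>+s. \<integral>\<^sup>+t. \<Psi> (ext s, t (Suc k)) \<partial>distr M ?PB ?B \<partial>distr M ?PA ?A)"
    unfolding joint by (subst B.nn_integral_fst[symmetric]) auto
  also have "\<dots> = (\<integral>\<^sup>+\<omega>. \<integral>\<^sup>+t. \<Psi> (ext (?A \<omega>), t (Suc k)) \<partial>distr M ?PB ?B \<partial>M)"
    by (rule nn_integral_distr) measurable
  also have "\<dots> = (\<integral>\<^sup>+\<omega>. \<integral>\<^sup>+y. \<Psi> (past k (path \<omega>), y) \<partial>\<mu> \<partial>M)"
  proof (rule nn_integral_cong)
    fix \<omega>
    have [measurable]: "(\<lambda>y. \<Psi> (past k (path \<omega>), y)) \<in> borel_measurable borel"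
      by (rule measurable_compose[OF _ assms]) (simp add: space_PiM)
    have "(\<integral>\<^sup>+t. \<Psi> (past k (path \<omega>), t (Suc k)) \<partial>distr M ?PB ?B) =
        (\<integral>\<^sup>+\<omega>'. \<Psi> (past k (path \<omega>), X (Suc k) \<omega>') \<partial>M)"
      by (subst nn_integral_distr) auto
    also have "\<dots> = (\<integral>\<^sup>+y. \<Psi> (past k (path \<omega>), y) \<partial>\<mu>)"
      unfolding X_law[of "Suc k", simplified, symmetric] by (subst nn_integral_distr) auto
    finally show "(\<integral>\<^sup>+t. \<Psi> (ext (?A \<omega>), t (Suc k)) \<partial>distr M ?PB ?B) = (\<integral>\<^sup>+y. \<Psi> (past k (path \<omega>), y) \<partial>\<mu>)"
      by (simp add: ext_past)
  qed
  finally show ?thesis .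
qed

lemma measurable_cdf_law[measurable]: "(\<lambda>x. emeasure \<mu> {..x}) \<in> borel_measurable borel"
proof -
  interpret law: prob_space \<mu> by (rule prob_space_law)
  have "(\<lambda>x. measure \<mu> {..x}) \<in> borel_measurable borel"
    by (rule borel_measurable_mono) (auto simp: mono_def intro!: law.finite_measure_mono)
  then show ?thesis by (simp add: law.emeasure_eq_measure)
qed

text \<open>Integrating out the last of the \<open>l\<close> terms contributes a factor \<open>P(X \<le> X\<^sub>k)\<close>, which is again a
  function of the past.\<close>

lemma nn_integral_stays_below:
  assumes [measurable]: "\<Psi> \<in> borel_measurable seqs" and k: "1 \<le> k"
  shows "(\<integral>\<^sup>+\<omega>. (if stays_below (path \<omega>) k l then \<Psi> (past k (path \<omega>)) else 0) \<partial>M) =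
    (\<integral>\<^sup>+\<omega>. \<Psi> (past k (path \<omega>)) * emeasure \<mu> {..X k \<omega>} ^ l \<partial>M)"
  using assms(1)
proof (induction l arbitrary: \<Psi>)
  case 0
  then show ?case by (simp add: stays_below_0)
next
  case (Suc l)
  interpret law: prob_space \<mu> by (rule prob_space_law)
  note [measurable] = Suc.prems
  define \<Theta> where "\<Theta> = (\<lambda>(s, y). if stays_below s k l \<and> y \<le> s k then \<Psi> (past k s) else 0)"
  have [measurable]: "\<Theta> \<in> borel_measurable (seqs \<Otimes>\<^sub>M borel)"
    unfolding \<Theta>_def by measurable
  define \<Psi>' where "\<Psi>' s = \<Psi> s * emeasure \<mu> {..s k}" for s
  have [measurable]: "\<Psi>' \<in> borel_measurable seqs"
    unfolding \<Psi>'_def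
    by (intro borel_measurable_times_ennreal Suc.prems measurable_compose[OF measurable_coord measurable_cdf_law])
  have "(\<integral>\<^sup>+\<omega>. (if stays_below (path \<omega>) k (Suc l) then \<Psi> (past k (path \<omega>)) else 0) \<partial>M) =
      (\<integral>\<^sup>+\<omega>. \<Theta> (past (k + l) (path \<omega>), X (Suc (k + l)) \<omega>) \<partial>M)"
    using k by (intro nn_integral_cong) (simp add: \<Theta>_def stays_below_Suc stays_below_past past_last past_past)
  also have "\<dots> = (\<integral>\<^sup>+\<omega>. \<integral>\<^sup>+y. \<Theta> (past (k + l) (path \<omega>), y) \<partial>\<mu> \<partial>M)"
    by (rule nn_integral_next) measurable
  also have "\<dots> = (\<integral>\<^sup>+\<omega>. (if stays_below (path \<omega>) k l then \<Psi>' (past k (path \<omega>)) else 0) \<partial>M)"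
  proof (rule nn_integral_cong)
    fix \<omega>
    have "(\<integral>\<^sup>+y. \<Theta> (past (k + l) (path \<omega>), y) \<partial>\<mu>) =
        (\<integral>\<^sup>+y. (if stays_below (path \<omega>) k l then \<Psi> (past k (path \<omega>)) else 0) * indicator {..X k \<omega>} y \<partial>\<mu>)"
      using k by (intro nn_integral_cong)
        (simp add: \<Theta>_def stays_below_past past_last past_past indicator_def)
    also have "\<dots> = (if stays_below (path \<omega>) k l then \<Psi>' (past k (path \<omega>)) else 0)"
      using k by (subst nn_integral_cmult_indicator) (auto simp: \<Psi>'_def past_last)
    finally show "(\<integral>\<^sup>+y. \<Theta> (past (k + l) (path \<omega>), y) \<partial>\<mu>) =
        (if stays_below (path \<omega>) k l then \<Psi>' (past k (path \<omega>)) else 0)" .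
  qed
  also have "\<dots> = (\<integral>\<^sup>+\<omega>. \<Psi> (past k (path \<omega>)) * emeasure \<mu> {..X k \<omega>} ^ Suc l \<partial>M)"
    using k by (subst Suc.IH) (auto simp: \<Psi>'_def past_last mult_ac)
  finally show ?case .
qed

lemma nn_integral_next_at:
  assumes [measurable]: "\<Phi> \<in> borel_measurable (seqs \<Otimes>\<^sub>M borel)" and k: "1 \<le> k"
  shows "(\<integral>\<^sup>+\<omega>. (if next_at (path \<omega>) k l then \<Phi> (past k (path \<omega>), X (Suc (k + l)) \<omega>) else 0) \<partial>M) =
    (\<integral>\<^sup>+\<omega>. (\<integral>\<^sup>+y. (if X k \<omega> < y then \<Phi> (past k (path \<omega>), y) else 0) \<partial>\<mu>) * emeasure \<mu> {..X k \<omega>} ^ l \<partial>M)"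
proof -
  interpret law: prob_space \<mu> by (rule prob_space_law)
  define \<Theta> where "\<Theta> = (\<lambda>(s, y). if stays_below s k l \<and> s k < y then \<Phi> (past k s, y) else 0)"
  have [measurable]: "\<Theta> \<in> borel_measurable (seqs \<Otimes>\<^sub>M borel)"
    unfolding \<Theta>_def by measurable
  define \<Psi> where "\<Psi> s = (\<integral>\<^sup>+y. (if s k < y then \<Phi> (past k s, y) else 0) \<partial>\<mu>)" for s
  have [measurable]: "\<Psi> \<in> borel_measurable seqs" unfolding \<Psi>_def by measurable
  have "(\<integral>\<^sup>+\<omega>. (if next_at (path \<omega>) k l then \<Phi> (past k (path \<omega>), X (Suc (k + l)) \<omega>) else 0) \<partial>M) =
      (\<integral>\<^sup>+\<omega>. \<Theta> (past (k + l) (path \<omega>), X (Suc (k + l)) \<omega>) \<partial>M)"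
    using k by (intro nn_integral_cong) (simp add: \<Theta>_def next_at_def stays_below_past past_last past_past)
  also have "\<dots> = (\<integral>\<^sup>+\<omega>. \<integral>\<^sup>+y. \<Theta> (past (k + l) (path \<omega>), y) \<partial>\<mu> \<partial>M)"
    by (rule nn_integral_next) measurable
  also have "\<dots> = (\<integral>\<^sup>+\<omega>. (if stays_below (path \<omega>) k l then \<Psi> (past k (path \<omega>)) else 0) \<partial>M)"
    using k by (intro nn_integral_cong)
      (auto simp: \<Theta>_def \<Psi>_def stays_below_past past_last past_past intro!: nn_integral_cong)
  also have "\<dots> = (\<integral>\<^sup>+\<omega>. \<Psi> (past k (path \<omega>)) * emeasure \<mu> {..X k \<omega>} ^ l \<partial>M)"
    using k by (intro nn_integral_stays_below) measurable
  finally show ?thesis using k by (simp add: \<Psi>_def past_last past_past cong: if_cong)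
qed

lemma suminf_waiting_time: "(\<Sum>l. emeasure \<mu> {..x} ^ l) = 1 / emeasure \<mu> {x<..}"
proof -
  interpret law: prob_space \<mu> by (rule prob_space_law)
  define p where "p = measure \<mu> {..x}"
  have "UNIV - {..x} = {x<..}" by auto
  then have q: "measure \<mu> {x<..} = 1 - p"
    using law.prob_compl[of "{..x}"] by (simp add: p_def)
  moreover have "measure \<mu> {x<..} \<noteq> 0"
    using exceeds[of x] by (simp add: law.emeasure_eq_measure)
  ultimately have p: "0 \<le> p" "p < 1"
    using measure_nonneg[of \<mu> "{x<..}"] by (auto simp: p_def order_less_le)
  then have "(\<lambda>l. p ^ l) sums (1 / (1 - p))" by (intro geometric_sums) auto
  then have "(\<Sum>l. ennreal (p ^ l)) = ennreal (1 / (1 - p))"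
    using p by (intro suminf_ennreal_eq) auto
  then show ?thesis
    using p by (simp add: law.emeasure_eq_measure q p_def[symmetric] ennreal_power
        divide_ennreal[of 1 "1 - p", simplified])
qed

text \<open>The mean of \<open>\<phi>(X)\<close> conditioned on \<open>X > r\<close>.\<close>

definition exceed :: "real \<Rightarrow> (real \<Rightarrow> ennreal) \<Rightarrow> ennreal" where
  "exceed r \<phi> = (\<integral>\<^sup>+y. (if r < y then \<phi> y else 0) \<partial>\<mu>) / emeasure \<mu> {r<..}"

text \<open>Summing over the time \<open>k\<close> of the \<open>m\<close>-th record and over the waiting time \<open>l\<close> for the next one, the powers
  of \<open>P(X \<le> X\<^sub>k)\<close> form a geometric series with sum \<open>1 / P(X > X\<^sub>k)\<close>. The indicators are present because
  the existence of infinitely many records is derived from this identity.\<close>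

lemma nn_integral_next_record_ex:
  assumes m: "1 \<le> m" and [measurable]: "\<Phi> \<in> borel_measurable (seqs \<Otimes>\<^sub>M borel)"
  shows "(\<integral>\<^sup>+\<omega>. (if \<exists>k. record_at (path \<omega>) (Suc m) k
        then \<Phi> (record_history m (path \<omega>), R (Suc m) \<omega>) else 0) \<partial>M) =
    (\<integral>\<^sup>+\<omega>. (if \<exists>k. record_at (path \<omega>) m k
        then exceed (R m \<omega>) (\<lambda>y. \<Phi> (record_history m (path \<omega>), y)) else 0) \<partial>M)"
proof -
  interpret law: prob_space \<mu> by (rule prob_space_law)
  \<comment> \<open>On \<open>record_at s m k\<close> the history of \<open>past k s\<close> is the one of \<open>s\<close>, so \<open>\<Theta> k\<close> is evaluated at pasts only.\<close>
  define \<Theta> where "\<Theta> k = (\<lambda>(s, y). if record_at s m k then \<Phi> (record_history m s, y) else 0)" for k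
  have [measurable]: "\<Theta> k \<in> borel_measurable (seqs \<Otimes>\<^sub>M borel)" for k
    unfolding \<Theta>_def by measurable
  have \<Theta>_past: "\<Theta> k (past k x, y) = (if record_at x m k then \<Phi> (record_history m x, y) else 0)" for k x y
    using record_at_cong[of k "past k x" x m] record_history_past[of x m k]
    by (auto simp: \<Theta>_def past_def[abs_def])
  let ?t = "\<lambda>\<omega> k l. if next_at (path \<omega>) k l then \<Theta> k (past k (path \<omega>), X (Suc (k + l)) \<omega>) else 0"
  have lhs: "(if \<exists>k. record_at (path \<omega>) (Suc m) k
        then \<Phi> (record_history m (path \<omega>), R (Suc m) \<omega>) else 0) = (\<Sum>k. \<Sum>l. ?t \<omega> k l)" for \<omega>
  proof (cases "\<exists>k. record_at (path \<omega>) m k")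
    case True
    then obtain k where k: "record_at (path \<omega>) m k" by auto
    then have k_iff: "record_at (path \<omega>) m k' \<longleftrightarrow> k' = k" for k' using record_at_unique by blast
    have "(\<Sum>k. \<Sum>l. ?t \<omega> k l) = (\<Sum>k'. if k' = k then \<Sum>l. ?t \<omega> k' l else 0)"
      proof (rule suminf_cong)
      fix k'
      show "(\<Sum>l. ?t \<omega> k' l) = (if k' = k then \<Sum>l. ?t \<omega> k' l else 0)"
        by (cases "k' = k") (simp_all only: \<Theta>_past k_iff if_True if_False if_cancel refl suminf_zero)
    qed
    also have "\<dots> = (\<Sum>l. ?t \<omega> k l)" by (rule suminf_single) auto
    also have "\<dots> = (\<Sum>l. if next_at (path \<omega>) k l then \<Phi> (record_history m (path \<omega>), X (Suc (k + l)) \<omega>) else 0)"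
      by (simp add: \<Theta>_past k_iff cong: if_cong)
    finally have *: "(\<Sum>k. \<Sum>l. ?t \<omega> k l) =
       (\<Sum>l. if next_at (path \<omega>) k l then \<Phi> (record_history m (path \<omega>), X (Suc (k + l)) \<omega>) else 0)" .
    show ?thesis
    proof (cases "\<exists>l. next_at (path \<omega>) k l")
      case True
      then obtain l where l: "next_at (path \<omega>) k l" by auto
      then have rec: "record_at (path \<omega>) (Suc m) (Suc (k + l))" using record_at_Suc_iff[OF k] by auto
      have "(\<Sum>l. if next_at (path \<omega>) k l then \<Phi> (record_history m (path \<omega>), X (Suc (k + l)) \<omega>) else 0) =
          \<Phi> (record_history m (path \<omega>), X (Suc (k + l)) \<omega>)"
        by (rule suminf_single, rule l, rule next_at_unique[OF _ l])
      then show ?thesis unfolding * using rec record_at_last(1)[OF rec] by auto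
    next
      case False
      then show ?thesis unfolding * using record_at_Suc_iff[OF k] by simp
    qed
  next
    case False
    moreover have "\<nexists>k. record_at (path \<omega>) (Suc m) k"
      using False record_at_earlier[of "path \<omega>" "Suc m" _ m] m by fastforce
    ultimately show ?thesis by (simp add: \<Theta>_past cong: if_cong)
  qed
  have rhs: "(\<Sum>k. \<Sum>l. (\<integral>\<^sup>+y. (if X k \<omega> < y then \<Theta> k (past k (path \<omega>), y) else 0) \<partial>\<mu>) * emeasure \<mu> {..X k \<omega>} ^ l) =
      (if \<exists>k. record_at (path \<omega>) m k
        then exceed (R m \<omega>) (\<lambda>y. \<Phi> (record_history m (path \<omega>), y)) else 0)" for \<omega>
  proof -
    have "(\<Sum>k. \<Sum>l. (\<integral>\<^sup>+y. (if X k \<omega> < y then \<Theta> k (past k (path \<omega>), y) else 0) \<partial>\<mu>) * emeasure \<mu> {..X k \<omega>} ^ l) =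
       (\<Sum>k. if record_at (path \<omega>) m k then exceed (X k \<omega>) (\<lambda>y. \<Phi> (record_history m (path \<omega>), y)) else 0)"
      by (intro suminf_cong) (simp add: \<Theta>_past exceed_def suminf_waiting_time ennreal_times_divide cong: if_cong)
    also have "\<dots> = (if \<exists>k. record_at (path \<omega>) m k
        then exceed (R m \<omega>) (\<lambda>y. \<Phi> (record_history m (path \<omega>), y)) else 0)"
    proof (cases "\<exists>k. record_at (path \<omega>) m k")
      case True
      then obtain k where k: "record_at (path \<omega>) m k" by auto
      then have k_iff: "record_at (path \<omega>) m k' \<longleftrightarrow> k' = k" for k' using record_at_unique by blast
      show ?thesis
        unfolding k_iff using record_at_last(1)[OF k] by (subst suminf_single[of _ k]) auto
    qed simp
    finally show ?thesis .
  qed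
  have term_eq: "(\<integral>\<^sup>+\<omega>. ?t \<omega> k l \<partial>M) =
      (\<integral>\<^sup>+\<omega>. (\<integral>\<^sup>+y. (if X k \<omega> < y then \<Theta> k (past k (path \<omega>), y) else 0) \<partial>\<mu>) * emeasure \<mu> {..X k \<omega>} ^ l \<partial>M)" for k l
  proof (cases "1 \<le> k")
    case False
    then have "\<not> record_at x m k" for x using record_at_pos by blast
    then show ?thesis by (simp add: \<Theta>_past cong: if_cong)
  qed (rule nn_integral_next_at, measurable)
  let ?s = "\<lambda>\<omega> k l. (\<integral>\<^sup>+y. (if X k \<omega> < y then \<Theta> k (past k (path \<omega>), y) else 0) \<partial>\<mu>) * emeasure \<mu> {..X k \<omega>} ^ l"
  have past_path: "(\<lambda>\<omega>. past k (path \<omega>)) \<in> M \<rightarrow>\<^sub>M seqs" for k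
    by (rule measurable_compose[OF measurable_path measurable_past])
  have next_pred: "Measurable.pred M (\<lambda>\<omega>. next_at (path \<omega>) k l)" for k l
    by (rule measurable_compose[OF measurable_path measurable_next_at])
  have \<Theta>_path: "(\<lambda>(\<omega>, y). \<Theta> k (past k (path \<omega>), y)) \<in> borel_measurable (M \<Otimes>\<^sub>M borel)" for k
    using past_path[of k] by measurable
  have meas_t: "(\<lambda>\<omega>. ?t \<omega> k l) \<in> borel_measurable M" for k l
    using past_path[of k] next_pred[of k l] by measurable
  have "(\<lambda>\<omega>. \<integral>\<^sup>+y. (if X k \<omega> < y then \<Theta> k (past k (path \<omega>), y) else 0) \<partial>\<mu>) \<in> borel_measurable M" for k
    using \<Theta>_path[of k] by measurable
  then have meas_s: "(\<lambda>\<omega>. ?s \<omega> k l) \<in> borel_measurable M" for k l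
    by measurable
  have "(\<integral>\<^sup>+\<omega>. (\<Sum>k. \<Sum>l. ?t \<omega> k l) \<partial>M) = (\<Sum>k. \<Sum>l. \<integral>\<^sup>+\<omega>. ?t \<omega> k l \<partial>M)"
    by (simp only: nn_integral_suminf meas_t borel_measurable_suminf_order)
  also have "\<dots> = (\<integral>\<^sup>+\<omega>. (\<Sum>k. \<Sum>l. ?s \<omega> k l) \<partial>M)"
    by (simp only: term_eq nn_integral_suminf meas_s borel_measurable_suminf_order)
  finally show ?thesis unfolding lhs rhs .
qed

text \<open>With \<open>\<Phi> = 1\<close> the previous lemma says that the probability of an \<open>m\<close>-th record does not depend on \<open>m\<close>.\<close>

lemma AE_record_at: "1 \<le> m \<Longrightarrow> AE \<omega> in M. \<exists>k. record_at (path \<omega>) m k"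
proof (induction m rule: dec_induct)
  case base
  then show ?case by simp
next
  case (step m)
  interpret law: prob_space \<mu> by (rule prob_space_law)
  have "exceed r (\<lambda>_. 1) = 1" for r
  proof -
    have "(\<integral>\<^sup>+y. (if r < y then 1 else 0) \<partial>\<mu>) = (\<integral>\<^sup>+y. indicator {r<..} y \<partial>\<mu>)"
      by (intro nn_integral_cong) (auto simp: indicator_def)
    then have "exceed r (\<lambda>_. 1) = emeasure \<mu> {r<..} / emeasure \<mu> {r<..}"
      by (simp add: exceed_def)
    also have "\<dots> = 1"
      using exceeds[of r] law.emeasure_finite[of "{r<..}"]
      by (intro ennreal_divide_self) (simp_all only: top.not_eq_extremum[symmetric] not_False_eq_True)
    finally show ?thesis .
  qed
  then have "(\<integral>\<^sup>+\<omega>. (if \<exists>k. record_at (path \<omega>) (Suc m) k then 1 else 0) \<partial>M) =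
      (\<integral>\<^sup>+\<omega>. (if \<exists>k. record_at (path \<omega>) m k then 1 else 0) \<partial>M)"
    using nn_integral_next_record_ex[of m "\<lambda>_. 1"] step.hyps by (simp cong: if_cong)
  also have "\<dots> = (\<integral>\<^sup>+\<omega>. 1 \<partial>M)"
    by (rule nn_integral_cong_AE) (use step.IH in auto)
  also have "\<dots> = 1" by (simp add: emeasure_space_1)
  finally have int: "(\<integral>\<^sup>+\<omega>. (if \<exists>k. record_at (path \<omega>) (Suc m) k then 1 else 0) \<partial>M) = 1" .
  let ?S = "{\<omega>\<in>space M. \<exists>k. record_at (path \<omega>) (Suc m) k}"
  have pred: "Measurable.pred M (\<lambda>\<omega>. \<exists>k. record_at (path \<omega>) (Suc m) k)"
    by (intro pred_intros_countable measurable_compose[OF measurable_path measurable_record_at])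
  then have S: "?S \<in> sets M" by (rule predE)
  have "emeasure M ?S = (\<integral>\<^sup>+\<omega>. indicator ?S \<omega> \<partial>M)" using S by simp
  also have "\<dots> = (\<integral>\<^sup>+\<omega>. (if \<exists>k. record_at (path \<omega>) (Suc m) k then 1 else 0) \<partial>M)"
    by (intro nn_integral_cong) (simp add: indicator_def)
  finally show ?case using S int by (intro AE_I_eq_1) auto
qed

text \<open>This is the Markov property: the law of the next record depends on the history only through the
  last record.\<close>

theorem nn_integral_next_record:
  assumes m: "1 \<le> m" and [measurable]: "\<Phi> \<in> borel_measurable (seqs \<Otimes>\<^sub>M borel)"
  shows "(\<integral>\<^sup>+\<omega>. \<Phi> (record_history m (path \<omega>), R (Suc m) \<omega>) \<partial>M) =
    (\<integral>\<^sup>+\<omega>. exceed (R m \<omega>) (\<lambda>y. \<Phi> (record_history m (path \<omega>), y)) \<partial>M)"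
proof -
  have "(\<integral>\<^sup>+\<omega>. \<Phi> (record_history m (path \<omega>), R (Suc m) \<omega>) \<partial>M) =
    (\<integral>\<^sup>+\<omega>. (if \<exists>k. record_at (path \<omega>) (Suc m) k
        then \<Phi> (record_history m (path \<omega>), R (Suc m) \<omega>) else 0) \<partial>M)"
    by (rule nn_integral_cong_AE, rule AE_mp[OF AE_record_at[of "Suc m"]], simp, rule AE_I2, rule impI)
       (simp only: if_True)
  also have "\<dots> = (\<integral>\<^sup>+\<omega>. (if \<exists>k. record_at (path \<omega>) m k
        then exceed (R m \<omega>) (\<lambda>y. \<Phi> (record_history m (path \<omega>), y)) else 0) \<partial>M)"
    by (rule nn_integral_next_record_ex[OF assms])
  also have "\<dots> = (\<integral>\<^sup>+\<omega>. exceed (R m \<omega>) (\<lambda>y. \<Phi> (record_history m (path \<omega>), y)) \<partial>M)"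
    by (rule nn_integral_cong_AE, rule AE_mp[OF AE_record_at[OF m]], rule AE_I2, rule impI) (simp only: if_True)
  finally show ?thesis .
qed

end

section \<open>Densities for later records\<close>

text \<open>The coordinate rules match every application of a function variable to an argument, so they are
  withdrawn before functions of real variables are treated.\<close>

declare measurable_coord[measurable del] measurable_coord_le[measurable del]

text \<open>If \<open>h\<close> is the derivative of \<open>H\<close>, this is the derivative in \<open>t\<close> of \<open>n w - w\<^sup>n\<close>, where
  \<open>w = (H t - H u) / (H v - H u)\<close>. For the cumulative hazard it is the sum over
  \<open>j \<in> {2..n}\<close> of the conditional densities of \<open>R\<^sub>j\<close> given \<open>R\<^sub>1 = u\<close> and \<open>R\<^sub>n\<^sub>+\<^sub>2 = v\<close>. The functions \<open>H\<close> and \<open>h\<close> are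
  arguments because the kernel is compared with the one for \<open>H t = t\<close>.\<close>

definition record_kernel :: "nat \<Rightarrow> (real \<Rightarrow> real) \<Rightarrow> (real \<Rightarrow> real) \<Rightarrow> real \<Rightarrow> real \<Rightarrow> real \<Rightarrow> real" where
  "record_kernel n H h u v t = indicator {u<..<v} t *
     (real n * (1 - ((H t - H u) / (H v - H u)) ^ (n - 1)) * h t / (H v - H u))"

lemma measurable_record_kernel[measurable (raw)]:
  assumes [measurable]: "H \<in> borel_measurable borel" "h \<in> borel_measurable borel"
    "u \<in> borel_measurable N" "v \<in> borel_measurable N" "t \<in> borel_measurable N"
  shows "(\<lambda>x. record_kernel n H h (u x) (v x) (t x)) \<in> borel_measurable N"
proof -
  have "(\<lambda>x. record_kernel n H h (u x) (v x) (t x)) =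
    (\<lambda>x. if u x < t x \<and> t x < v x then
       real n * (1 - ((H (t x) - H (u x)) / (H (v x) - H (u x))) ^ (n - 1)) * h (t x) / (H (v x) - H (u x)) else 0)"
    by (auto simp: fun_eq_iff record_kernel_def)
  also have "\<dots> \<in> borel_measurable N"
    by measurable
  finally show ?thesis .
qed

text \<open>The binomial theorem for \<open>(a + b)\<^sup>m\<close> without its last term, in the indexing of the records \<open>R\<^sub>2\<close> to
  \<open>R\<^sub>m\<^sub>+\<^sub>1\<close>; the missing term belongs to \<open>R\<^sub>m\<^sub>+\<^sub>2\<close>, the last record before the outer one.\<close>

lemma sum_binomial_weights:
  fixes a b :: real
  shows "(\<Sum>j = 2..Suc m. a ^ (j - 2) / fact (j - 2) * (b ^ (Suc (Suc m) - j) / fact (Suc (Suc m) - j))) =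
    ((a + b) ^ m - a ^ m) / fact m"
proof -
  let ?t = "\<lambda>i. a ^ i / fact i * (b ^ (m - i) / fact (m - i))"
  have "(\<Sum>j = 2..Suc m. a ^ (j - 2) / fact (j - 2) * (b ^ (Suc (Suc m) - j) / fact (Suc (Suc m) - j))) = (\<Sum>i<m. ?t i)"
    by (rule sum.reindex_bij_witness[of _ "\<lambda>i. i + 2" "\<lambda>j. j - 2"]) (auto simp: Suc_diff_le)
  also have "\<dots> = (\<Sum>i\<le>m. ?t i) - a ^ m / fact m"
    by (simp add: lessThan_Suc_atMost[symmetric])
  also have "(\<Sum>i\<le>m. ?t i) = (\<Sum>i\<le>m. of_nat (m choose i) * a ^ i * b ^ (m - i)) / fact m"
    unfolding sum_divide_distrib by (intro sum.cong) (auto simp: binomial_fact)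
  finally show ?thesis by (simp add: binomial_ring diff_divide_distrib)
qed

text \<open>Differentiability is required at positive points only, as the density may be unbounded near 0.
  This suffices because all records are positive almost surely.\<close>

locale iid_density = iid_sequence M X \<mu>
  for M :: "'a measure" and X :: "nat \<Rightarrow> 'a \<Rightarrow> real" and \<mu> :: "real measure" +
  fixes F f :: "real \<Rightarrow> real"
  assumes f_borel[measurable]: "f \<in> borel_measurable borel"
    and f_nonneg: "\<And>x. 0 \<le> f x"
    and f_eq_0: "\<And>x. x \<le> 0 \<Longrightarrow> f x = 0"
    and law_density: "\<mu> = density lborel (\<lambda>x. ennreal (f x))"
    and F_borel[measurable]: "F \<in> borel_measurable borel"
    and law_tail: "\<And>x. emeasure \<mu> {x<..} = ennreal (1 - F x)"
    and F_less: "\<And>x. F x < 1"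
    and F_deriv: "\<And>x. 0 < x \<Longrightarrow> (F has_real_derivative f x) (at x)"
begin

definition H :: "real \<Rightarrow> real" where "H = cum_hazard F"

definition h :: "real \<Rightarrow> real" where "h x = f x / (1 - F x)"

lemma H_borel[measurable]: "H \<in> borel_measurable borel"
  unfolding H_def cum_hazard_def[abs_def] by measurable

lemma h_borel[measurable]: "h \<in> borel_measurable borel"
  unfolding h_def[abs_def] by measurable

lemma h_nonneg: "0 \<le> h x"
  using f_nonneg[of x] F_less[of x] by (simp add: h_def)

lemma H_deriv: "0 < x \<Longrightarrow> (H has_real_derivative h x) (at x)"
  unfolding H_def cum_hazard_def[abs_def] h_def using F_less[of x]
  by (auto intro!: derivative_eq_intros F_deriv)

lemma H_mono: "0 < x \<Longrightarrow> x \<le> y \<Longrightarrow> H x \<le> H y"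
proof (rule DERIV_nonneg_imp_nondecreasing[of x y H])
  fix z assume "0 < x" "x \<le> z"
  then show "\<exists>d. (H has_real_derivative d) (at z) \<and> 0 \<le> d"
    using H_deriv[of z] h_nonneg[of z] by (intro exI[of _ "h z"]) auto
qed

text \<open>The density at \<open>y\<close> of the record that comes \<open>k + 1\<close> records after a record of value \<open>r\<close>.\<close>

definition step_density :: "nat \<Rightarrow> real \<Rightarrow> real \<Rightarrow> real" where
  "step_density k r y = indicator {r<..} y * ((H y - H r) ^ k / fact k * f y / (1 - F r))"

lemma step_density_alt: "step_density k r y = (if r < y then (H y - H r) ^ k / fact k * f y / (1 - F r) else 0)"
  by (simp add: step_density_def)

lemma step_density_nonneg: "0 < r \<Longrightarrow> 0 \<le> step_density k r y"
  unfolding step_density_alt using F_less[of r] f_nonneg[of y] H_mono[of r y] by auto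

lemma measurable_step_density[measurable (raw)]:
  assumes [measurable]: "r \<in> borel_measurable N" "y \<in> borel_measurable N"
  shows "(\<lambda>x. step_density k (r x) (y x)) \<in> borel_measurable N"
  unfolding step_density_alt by measurable

lemma exceed_eq:
  assumes [measurable]: "\<phi> \<in> borel_measurable borel"
  shows "exceed r \<phi> = (\<integral>\<^sup>+y. \<phi> y * ennreal (step_density 0 r y) \<partial>lborel)"
proof -
  have "exceed r \<phi> = (\<integral>\<^sup>+y. ennreal (f y) * (if r < y then \<phi> y else 0) \<partial>lborel) / ennreal (1 - F r)"
    by (simp add: exceed_def law_tail) (simp add: law_density nn_integral_density)
  also have "\<dots> = (\<integral>\<^sup>+y. ennreal (f y) * (if r < y then \<phi> y else 0) / ennreal (1 - F r) \<partial>lborel)"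
    by (rule nn_integral_divide[symmetric]) measurable
  also have "\<dots> = (\<integral>\<^sup>+y. \<phi> y * ennreal (step_density 0 r y) \<partial>lborel)"
    using F_less[of r] f_nonneg
    by (intro nn_integral_cong)
       (simp add: step_density_alt divide_ennreal[symmetric] ennreal_times_divide mult.commute)
  finally show ?thesis .
qed

text \<open>The Chapman-Kolmogorov equation for one further step: the integrand is, up to factors that do not
  depend on \<open>z\<close>, the derivative of a power of \<open>H z - H r\<close>.\<close>

lemma step_density_compose:
  assumes r: "0 < r"
  shows "(\<integral>\<^sup>+z. ennreal (step_density k r z) * ennreal (step_density 0 z y) \<partial>lborel) = ennreal (step_density (Suc k) r y)"
proof (cases "r < y")
  case True
  let ?g = "\<lambda>z. (H z - H r) ^ k / fact k * h z" and ?G = "\<lambda>z. (H z - H r) ^ Suc k / fact (Suc k)"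
  let ?c = "f y / (1 - F r)"
  have c: "0 \<le> ?c" using f_nonneg F_less[of r] by simp
  have g: "0 \<le> ?g z" if "r \<le> z" for z
    using that r H_mono[of r z] h_nonneg[of z] by simp
  have "(\<integral>\<^sup>+z. ennreal (step_density k r z) * ennreal (step_density 0 z y) \<partial>lborel) =
      (\<integral>\<^sup>+z. ennreal ?c * (ennreal (?g z) * indicator {r..y} z) \<partial>lborel)"
  proof (rule nn_integral_cong_AE)
    have eq: "ennreal (step_density k r z) * ennreal (step_density 0 z y) = ennreal ?c * (ennreal (?g z) * indicator {r..y} z)"
      if "z \<noteq> r" "z \<noteq> y" for z
    proof (cases "r < z \<and> z < y")
      case True
      then have "step_density k r z * step_density 0 z y = ?c * ?g z"
        by (simp add: step_density_alt h_def mult_ac)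
      then show ?thesis
        using True r step_density_nonneg[of r k z] step_density_nonneg[of z 0 y] c g[of z]
        by (simp add: ennreal_mult[symmetric])
    qed (use that in \<open>auto simp: step_density_alt indicator_def\<close>)
    show "AE z in lborel. ennreal (step_density k r z) * ennreal (step_density 0 z y) = ennreal ?c * (ennreal (?g z) * indicator {r..y} z)"
      using AE_lborel_singleton[of r] AE_lborel_singleton[of y] by eventually_elim (rule eq)
  qed
  also have "\<dots> = ennreal ?c * (\<integral>\<^sup>+z. ennreal (?g z) * indicator {r..y} z \<partial>lborel)"
    by (rule nn_integral_cmult) measurable
  also have "(\<integral>\<^sup>+z. ennreal (?g z) * indicator {r..y} z \<partial>lborel) = ennreal (?G y - ?G r)"
  proof (rule nn_integral_FTC_Icc)
    fix z assume z: "z \<in> {r..y}"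
    then have "((\<lambda>z. H z - H r) has_real_derivative h z) (at z)"
      using r by (auto intro!: derivative_eq_intros H_deriv)
    then have "(?G has_real_derivative of_nat (Suc k) * (h z * (H z - H r) ^ (Suc k - Suc 0)) / fact (Suc k)) (at z)"
      by (intro DERIV_cdivide DERIV_power)
    also have "of_nat (Suc k) * (h z * (H z - H r) ^ (Suc k - Suc 0)) / fact (Suc k) = ?g z"
      unfolding fact_Suc by (simp add: mult.commute del: of_nat_Suc)
    finally show "(?G has_real_derivative ?g z) (at z)" .
    show "0 \<le> ?g z" using g z by auto
  qed (use True in auto)
  also have "ennreal ?c * ennreal (?G y - ?G r) = ennreal (step_density (Suc k) r y)"
    using True c H_mono[of r y] r by (simp add: step_density_alt ennreal_mult[symmetric] mult_ac)
  finally show ?thesis .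
next
  case False
  then have zero: "ennreal (step_density k r z) * ennreal (step_density 0 z y) = 0" for z
    unfolding step_density_alt using False by auto
  have "(\<integral>\<^sup>+z. ennreal (step_density k r z) * ennreal (step_density 0 z y) \<partial>lborel) = 0"
    unfolding zero by simp
  moreover have "step_density (Suc k) r y = 0" using False by (simp add: step_density_alt)
  ultimately show ?thesis by simp
qed

lemma AE_first_record_pos: "AE \<omega> in M. 0 < R 1 \<omega>"
proof -
  have "emeasure \<mu> {..0} = (\<integral>\<^sup>+x. ennreal (f x) * indicator {..0} x \<partial>lborel)"
    by (simp add: law_density emeasure_density)
  also have "\<dots> = (\<integral>\<^sup>+(x::real). 0 \<partial>lborel)"
    by (intro nn_integral_cong) (auto simp: indicator_def f_eq_0)
  finally have "emeasure (distr M borel (X 1)) {..0} = 0" using X_law[of 1] by simp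
  then have "emeasure M {\<omega>\<in>space M. X 1 \<omega> \<le> 0} = 0"
    by (subst (asm) emeasure_distr) (auto simp: vimage_def Int_def conj_commute)
  then have "AE \<omega> in M. \<not> X 1 \<omega> \<le> 0"
    by (intro AE_I[where N="{\<omega>\<in>space M. X 1 \<omega> \<le> 0}"]) auto
  then show ?thesis by (simp add: record_value_def not_le)
qed

lemma AE_record_pos: "1 \<le> m \<Longrightarrow> AE \<omega> in M. 0 < R m \<omega>"
  using AE_first_record_pos by eventually_elim (use record_value_mono_le[of 1 m] in \<open>fastforce intro: less_le_trans\<close>)

lemma record_history_shorter: "m \<le> m' \<Longrightarrow> past m (record_history m' x) = record_history m x"
  by (auto simp: past_def record_history_def fun_eq_iff)

text \<open>Induction on \<open>k\<close> by conditioning on the last step. The history may contain records up to \<open>R\<^sub>m\<close> only,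
  so it is cut back before the induction hypothesis is applied.\<close>

theorem nn_integral_later_record:
  assumes m: "1 \<le> m" and "\<Phi> \<in> borel_measurable (seqs \<Otimes>\<^sub>M borel)"
  shows "(\<integral>\<^sup>+\<omega>. \<Phi> (record_history m (path \<omega>), R (m + Suc k) \<omega>) \<partial>M) =
    (\<integral>\<^sup>+\<omega>. \<integral>\<^sup>+y. \<Phi> (record_history m (path \<omega>), y) * ennreal (step_density k (R m \<omega>) y) \<partial>lborel \<partial>M)"
  using assms(2)
proof (induction k arbitrary: \<Phi>)
  case 0
  note [measurable] = 0
  have "(\<lambda>y. \<Phi> (s, y)) \<in> borel_measurable borel" for s
    by (rule measurable_compose[OF _ 0]) (simp add: space_PiM)
  then show ?case
    using nn_integral_next_record[OF m 0] by (simp add: exceed_eq)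
next
  case (Suc k)
  note [measurable] = Suc.prems
  have \<Phi>_section: "(\<lambda>y. \<Phi> (s, y)) \<in> borel_measurable borel" for s
    by (rule measurable_compose[OF _ Suc.prems]) (simp add: space_PiM)
  define \<Psi> where "\<Psi> = (\<lambda>(s, z). \<integral>\<^sup>+y. \<Phi> (s, y) * ennreal (step_density 0 z y) \<partial>lborel)"
  have \<Psi>_measurable: "\<Psi> \<in> borel_measurable (seqs \<Otimes>\<^sub>M borel)"
    unfolding \<Psi>_def by measurable
  define \<Phi>' where "\<Phi>' = (\<lambda>(s, y). \<Phi> (past m s, y))"
  have \<Phi>'_measurable: "\<Phi>' \<in> borel_measurable (seqs \<Otimes>\<^sub>M borel)"
    unfolding \<Phi>'_def by measurable
  have "(\<integral>\<^sup>+\<omega>. \<Phi> (record_history m (path \<omega>), R (m + Suc (Suc k)) \<omega>) \<partial>M) =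
      (\<integral>\<^sup>+\<omega>. \<Phi>' (record_history (m + Suc k) (path \<omega>), R (Suc (m + Suc k)) \<omega>) \<partial>M)"
    by (simp add: \<Phi>'_def record_history_shorter)
  also have "\<dots> = (\<integral>\<^sup>+\<omega>. exceed (R (m + Suc k) \<omega>) (\<lambda>y. \<Phi>' (record_history (m + Suc k) (path \<omega>), y)) \<partial>M)"
    using m by (intro nn_integral_next_record \<Phi>'_measurable) auto
  also have "\<dots> = (\<integral>\<^sup>+\<omega>. \<Psi> (record_history m (path \<omega>), R (m + Suc k) \<omega>) \<partial>M)"
    using \<Phi>_section by (simp add: \<Phi>'_def \<Psi>_def record_history_shorter exceed_eq)
  also have "\<dots> = (\<integral>\<^sup>+\<omega>. \<integral>\<^sup>+z. \<Psi> (record_history m (path \<omega>), z) * ennreal (step_density k (R m \<omega>) z) \<partial>lborel \<partial>M)"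
    by (rule Suc.IH[OF \<Psi>_measurable])
  also have "\<dots> = (\<integral>\<^sup>+\<omega>. \<integral>\<^sup>+y. \<Phi> (record_history m (path \<omega>), y) * ennreal (step_density (Suc k) (R m \<omega>) y) \<partial>lborel \<partial>M)"
  proof (rule nn_integral_cong_AE)
    have "(\<integral>\<^sup>+z. \<Psi> (s, z) * ennreal (step_density k r z) \<partial>lborel) =
        (\<integral>\<^sup>+y. \<Phi> (s, y) * ennreal (step_density (Suc k) r y) \<partial>lborel)" if r: "0 < r" for s r
    proof -
      note [measurable] = \<Phi>_section[of s]
      have "(\<integral>\<^sup>+z. \<Psi> (s, z) * ennreal (step_density k r z) \<partial>lborel) =
          (\<integral>\<^sup>+z. \<integral>\<^sup>+y. \<Phi> (s, y) * ennreal (step_density 0 z y) * ennreal (step_density k r z) \<partial>lborel \<partial>lborel)"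
        by (simp add: \<Psi>_def nn_integral_multc)
      also have "\<dots> = (\<integral>\<^sup>+y. \<integral>\<^sup>+z. \<Phi> (s, y) * ennreal (step_density 0 z y) * ennreal (step_density k r z) \<partial>lborel \<partial>lborel)"
        by (rule lborel_pair.Fubini') measurable
      also have "\<dots> = (\<integral>\<^sup>+y. \<integral>\<^sup>+z. \<Phi> (s, y) * (ennreal (step_density k r z) * ennreal (step_density 0 z y)) \<partial>lborel \<partial>lborel)"
        by (simp only: mult_ac)
      also have "\<dots> = (\<integral>\<^sup>+y. \<Phi> (s, y) * ennreal (step_density (Suc k) r y) \<partial>lborel)"
        by (simp add: nn_integral_cmult step_density_compose[OF r])
      finally show ?thesis .
    qed
    then show "AE \<omega> in M. (\<integral>\<^sup>+z. \<Psi> (record_history m (path \<omega>), z) * ennreal (step_density k (R m \<omega>) z) \<partial>lborel) =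
        (\<integral>\<^sup>+y. \<Phi> (record_history m (path \<omega>), y) * ennreal (step_density (Suc k) (R m \<omega>) y) \<partial>lborel)"
      using AE_record_pos[OF m] by (auto elim: eventually_mono)
  qed
  finally show ?case .
qed

lemma nn_integral_first_and_later:
  assumes [measurable]: "\<Phi> \<in> borel_measurable (borel \<Otimes>\<^sub>M borel)"
  shows "(\<integral>\<^sup>+\<omega>. \<Phi> (R 1 \<omega>, R (n + 2) \<omega>) \<partial>M) =
    (\<integral>\<^sup>+\<omega>. \<integral>\<^sup>+v. \<Phi> (R 1 \<omega>, v) * ennreal (step_density n (R 1 \<omega>) v) \<partial>lborel \<partial>M)"
proof -
  note [measurable] = measurable_coord
  have "(\<lambda>(s, y). \<Phi> (s 1, y)) \<in> borel_measurable (seqs \<Otimes>\<^sub>M borel)" by measurable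
  from nn_integral_later_record[OF _ this, of 1 n] show ?thesis
    by (simp add: record_history_def)
qed

lemma nn_integral_three_records:
  assumes [measurable]: "\<Phi> \<in> borel_measurable (borel \<Otimes>\<^sub>M borel \<Otimes>\<^sub>M borel)" and j: "2 \<le> j" "j \<le> n + 1"
  shows "(\<integral>\<^sup>+\<omega>. \<Phi> (R 1 \<omega>, R j \<omega>, R (n + 2) \<omega>) \<partial>M) =
    (\<integral>\<^sup>+\<omega>. \<integral>\<^sup>+t. \<integral>\<^sup>+v. \<Phi> (R 1 \<omega>, t, v) * ennreal (step_density (n + 1 - j) t v) *
       ennreal (step_density (j - 2) (R 1 \<omega>) t) \<partial>lborel \<partial>lborel \<partial>M)"
proof -
  define \<Psi> where "\<Psi> = (\<lambda>(u, t). \<integral>\<^sup>+v. \<Phi> (u, t, v) * ennreal (step_density (n + 1 - j) t v) \<partial>lborel)"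
  have [measurable]: "\<Psi> \<in> borel_measurable (borel \<Otimes>\<^sub>M borel)"
    unfolding \<Psi>_def by measurable
  note [measurable] = measurable_coord
  have "(\<lambda>(s, v). \<Phi> (s 1, s j, v)) \<in> borel_measurable (seqs \<Otimes>\<^sub>M borel)" by measurable
  from nn_integral_later_record[OF _ this, of j "n + 1 - j"] j
  have "(\<integral>\<^sup>+\<omega>. \<Phi> (R 1 \<omega>, R j \<omega>, R (n + 2) \<omega>) \<partial>M) = (\<integral>\<^sup>+\<omega>. \<Psi> (R 1 \<omega>, R j \<omega>) \<partial>M)"
    by (simp add: record_history_def \<Psi>_def)
  also have "\<dots> = (\<integral>\<^sup>+\<omega>. \<integral>\<^sup>+t. \<Psi> (R 1 \<omega>, t) * ennreal (step_density (j - 2) (R 1 \<omega>) t) \<partial>lborel \<partial>M)"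
    using nn_integral_first_and_later[of \<Psi> "j - 2"] j by (simp add: Suc_diff_Suc numeral_2_eq_2 Suc_diff_le)
  finally show ?thesis
    by (simp add: \<Psi>_def nn_integral_multc)
qed

text \<open>When \<open>H u = H v\<close> both sides vanish, because then every weight contains a positive power of 0 (this is where
  \<open>n \<ge> 2\<close> enters) and the kernel is a quotient by 0.\<close>

lemma sum_step_density:
  assumes n: "2 \<le> n" and u: "0 < u"
  shows "(\<Sum>j = 2..n. step_density (j - 2) u t * step_density (n + 1 - j) t v) = step_density n u v * record_kernel n H h u v t"
proof (cases "u < t \<and> t < v")
  case True
  obtain m where m: "n = Suc m" "1 \<le> m" using n by (cases n) auto
  define a b where "a = H t - H u" and "b = H v - H t"
  have ab: "0 \<le> a" "0 \<le> b" "H v - H u = a + b"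
    using True u H_mono[of u t] H_mono[of t v] by (auto simp: a_def b_def)
  have "(\<Sum>j = 2..n. step_density (j - 2) u t * step_density (n + 1 - j) t v) =
      (\<Sum>j = 2..Suc m. (f v / (1 - F u) * h t) *
        (a ^ (j - 2) / fact (j - 2) * (b ^ (Suc (Suc m) - j) / fact (Suc (Suc m) - j))))"
    using True by (intro sum.cong) (auto simp: m step_density_alt a_def b_def h_def mult_ac)
  also have "\<dots> = (f v / (1 - F u) * h t) * (((a + b) ^ m - a ^ m) / fact m)"
    by (simp only: sum_distrib_left[symmetric] sum_binomial_weights)
  also have "\<dots> = step_density n u v * record_kernel n H h u v t"
  proof (cases "a + b = 0")
    case True
    then have "a = 0" "b = 0" using ab by auto
    then show ?thesis using ab m by (simp add: record_kernel_def power_0_left)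
  next
    case False
    have "(a + b) ^ m * (1 - (a / (a + b)) ^ m) = (a + b) ^ m - a ^ m"
      using False by (simp add: right_diff_distrib power_divide)
    moreover have "c ^ m * q / fact m = c ^ Suc m / fact (Suc m) * (real (Suc m) * q / c)" if "c \<noteq> 0" for c q :: real
      using that unfolding fact_Suc by (simp add: mult_ac del: of_nat_Suc)
    ultimately have "((a + b) ^ m - a ^ m) / fact m =
        (a + b) ^ Suc m / fact (Suc m) * (real (Suc m) * (1 - (a / (a + b)) ^ m) / (a + b))"
      using False by metis
    then show ?thesis
      using True by (simp add: record_kernel_def step_density_alt ab(3) a_def[symmetric] m)
  qed
  finally show ?thesis .
qed (auto simp: step_density_alt record_kernel_def)

lemma record_kernel_nonneg:
  assumes "0 < u"
  shows "0 \<le> record_kernel n H h u v t"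
proof (cases "u < t \<and> t < v")
  case True
  then have "H u \<le> H t" "H t \<le> H v" using assms H_mono by auto
  then have "0 \<le> (H t - H u) / (H v - H u)" "(H t - H u) / (H v - H u) \<le> 1"
    by (auto simp: divide_le_eq_1)
  then have "((H t - H u) / (H v - H u)) ^ (n - 1) \<le> 1" by (intro power_le_one)
  then show ?thesis
    using \<open>H u \<le> H t\<close> \<open>H t \<le> H v\<close> h_nonneg[of t] by (simp add: record_kernel_def)
qed (auto simp: record_kernel_def)

text \<open>The unnormalized form of the conditional expectation: \<open>\<Theta>\<close> is a test function of the two outer
  records. Both sides are reduced to integrals against the law of \<open>R\<^sub>1\<close>, where they agree by
  \<open>sum_step_density\<close>.\<close>

theorem nn_integral_inner_records:
  assumes n: "2 \<le> n" and [measurable]: "\<Theta> \<in> borel_measurable (borel \<Otimes>\<^sub>M borel)" "\<phi> \<in> borel_measurable borel"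
  shows "(\<integral>\<^sup>+\<omega>. \<Theta> (R 1 \<omega>, R (n + 2) \<omega>) * (\<Sum>j = 2..n. \<phi> (R j \<omega>)) \<partial>M) =
    (\<integral>\<^sup>+\<omega>. \<Theta> (R 1 \<omega>, R (n + 2) \<omega>) *
      (\<integral>\<^sup>+t. \<phi> t * ennreal (record_kernel n H h (R 1 \<omega>) (R (n + 2) \<omega>) t) \<partial>lborel) \<partial>M)"
proof -
  let ?K = "record_kernel n H h"
  let ?T = "\<lambda>j u t v. \<Theta> (u, v) * \<phi> t * ennreal (step_density (n + 1 - j) t v) * ennreal (step_density (j - 2) u t)"
  have "(\<integral>\<^sup>+\<omega>. \<Theta> (R 1 \<omega>, R (n + 2) \<omega>) * (\<Sum>j = 2..n. \<phi> (R j \<omega>)) \<partial>M) =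
      (\<Sum>j = 2..n. \<integral>\<^sup>+\<omega>. \<Theta> (R 1 \<omega>, R (n + 2) \<omega>) * \<phi> (R j \<omega>) \<partial>M)"
    by (subst nn_integral_sum[symmetric]) (auto simp: sum_distrib_left)
  also have "\<dots> = (\<Sum>j = 2..n. \<integral>\<^sup>+\<omega>. \<integral>\<^sup>+t. \<integral>\<^sup>+v. ?T j (R 1 \<omega>) t v \<partial>lborel \<partial>lborel \<partial>M)"
  proof (rule sum.cong[OF refl])
    fix j assume j: "j \<in> {2..n}"
    have "(\<lambda>(u, t, v). \<Theta> (u, v) * \<phi> t) \<in> borel_measurable (borel \<Otimes>\<^sub>M borel \<Otimes>\<^sub>M borel)" by measurable
    from nn_integral_three_records[OF this, of j n] j
    show "(\<integral>\<^sup>+\<omega>. \<Theta> (R 1 \<omega>, R (n + 2) \<omega>) * \<phi> (R j \<omega>) \<partial>M) =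
        (\<integral>\<^sup>+\<omega>. \<integral>\<^sup>+t. \<integral>\<^sup>+v. ?T j (R 1 \<omega>) t v \<partial>lborel \<partial>lborel \<partial>M)"
      by simp
  qed
  also have "\<dots> = (\<integral>\<^sup>+\<omega>. (\<Sum>j = 2..n. \<integral>\<^sup>+t. \<integral>\<^sup>+v. ?T j (R 1 \<omega>) t v \<partial>lborel \<partial>lborel) \<partial>M)"
    by (subst nn_integral_sum) auto
  also have "\<dots> = (\<integral>\<^sup>+\<omega>. \<integral>\<^sup>+v. (\<Theta> (R 1 \<omega>, v) * (\<integral>\<^sup>+t. \<phi> t * ennreal (?K (R 1 \<omega>) v t) \<partial>lborel)) *
      ennreal (step_density n (R 1 \<omega>) v) \<partial>lborel \<partial>M)"
  proof (rule nn_integral_cong_AE)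
    have eq: "(\<Sum>j = 2..n. \<integral>\<^sup>+t. \<integral>\<^sup>+v. ?T j u t v \<partial>lborel \<partial>lborel) =
        (\<integral>\<^sup>+v. (\<Theta> (u, v) * (\<integral>\<^sup>+t. \<phi> t * ennreal (?K u v t) \<partial>lborel)) * ennreal (step_density n u v) \<partial>lborel)"
      if u: "0 < u" for u
    proof -
      have "(\<Sum>j = 2..n. \<integral>\<^sup>+t. \<integral>\<^sup>+v. ?T j u t v \<partial>lborel \<partial>lborel) =
          (\<integral>\<^sup>+t. \<integral>\<^sup>+v. (\<Sum>j = 2..n. ?T j u t v) \<partial>lborel \<partial>lborel)"
        by (simp add: nn_integral_sum)
      also have "\<dots> = (\<integral>\<^sup>+t. \<integral>\<^sup>+v. \<Theta> (u, v) * \<phi> t * (ennreal (step_density n u v) * ennreal (?K u v t)) \<partial>lborel \<partial>lborel)"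
      proof (intro nn_integral_cong)
        fix t v
        have nonneg: "0 \<le> step_density (j - 2) u t * step_density (n + 1 - j) t v" for j
        proof (cases "u < t")
          case True
          then show ?thesis using u by (intro mult_nonneg_nonneg step_density_nonneg) auto
        qed (simp add: step_density_alt[of _ u t])
        have "ennreal (step_density (n + 1 - j) t v) * ennreal (step_density (j - 2) u t) =
            ennreal (step_density (j - 2) u t * step_density (n + 1 - j) t v)" for j
        proof (cases "u < t")
          case True
          then show ?thesis
            using u by (subst ennreal_mult) (auto intro!: step_density_nonneg simp: mult.commute)
        qed (simp add: step_density_alt[of _ u t])
        then have "(\<Sum>j = 2..n. ennreal (step_density (n + 1 - j) t v) * ennreal (step_density (j - 2) u t)) =
            (\<Sum>j = 2..n. ennreal (step_density (j - 2) u t * step_density (n + 1 - j) t v))"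
          by simp
        also have "\<dots> = ennreal (\<Sum>j = 2..n. step_density (j - 2) u t * step_density (n + 1 - j) t v)"
          by (rule sum_ennreal) (rule nonneg)
        also have "\<dots> = ennreal (step_density n u v) * ennreal (?K u v t)"
          unfolding sum_step_density[OF n u] by (rule ennreal_mult[OF step_density_nonneg[OF u] record_kernel_nonneg[OF u]])
        finally show "(\<Sum>j = 2..n. ?T j u t v) = \<Theta> (u, v) * \<phi> t * (ennreal (step_density n u v) * ennreal (?K u v t))"
          by (simp only: sum_distrib_left[symmetric] mult.assoc)
      qed
      also have "\<dots> = (\<integral>\<^sup>+v. \<integral>\<^sup>+t. \<Theta> (u, v) * \<phi> t * (ennreal (step_density n u v) * ennreal (?K u v t)) \<partial>lborel \<partial>lborel)"
        by (intro lborel_pair.Fubini') measurable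
      also have "\<dots> = (\<integral>\<^sup>+v. (\<Theta> (u, v) * (\<integral>\<^sup>+t. \<phi> t * ennreal (?K u v t) \<partial>lborel)) * ennreal (step_density n u v) \<partial>lborel)"
      proof (intro nn_integral_cong)
        fix v
        have "(\<integral>\<^sup>+t. \<Theta> (u, v) * \<phi> t * (ennreal (step_density n u v) * ennreal (?K u v t)) \<partial>lborel) =
            (\<integral>\<^sup>+t. (\<Theta> (u, v) * ennreal (step_density n u v)) * (\<phi> t * ennreal (?K u v t)) \<partial>lborel)"
          by (simp only: mult_ac)
        also have "\<dots> = (\<Theta> (u, v) * ennreal (step_density n u v)) * (\<integral>\<^sup>+t. \<phi> t * ennreal (?K u v t) \<partial>lborel)"
          by (rule nn_integral_cmult) measurable
        finally show "(\<integral>\<^sup>+t. \<Theta> (u, v) * \<phi> t * (ennreal (step_density n u v) * ennreal (?K u v t)) \<partial>lborel) =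
            (\<Theta> (u, v) * (\<integral>\<^sup>+t. \<phi> t * ennreal (?K u v t) \<partial>lborel)) * ennreal (step_density n u v)"
          by (simp only: mult_ac)
      qed
      finally show ?thesis .
    qed
    show "AE \<omega> in M. (\<Sum>j = 2..n. \<integral>\<^sup>+t. \<integral>\<^sup>+v. ?T j (R 1 \<omega>) t v \<partial>lborel \<partial>lborel) =
        (\<integral>\<^sup>+v. (\<Theta> (R 1 \<omega>, v) * (\<integral>\<^sup>+t. \<phi> t * ennreal (?K (R 1 \<omega>) v t) \<partial>lborel)) *
          ennreal (step_density n (R 1 \<omega>) v) \<partial>lborel)"
      using AE_first_record_pos by eventually_elim (rule eq)
  qed
  also have "\<dots> = (\<integral>\<^sup>+\<omega>. \<Theta> (R 1 \<omega>, R (n + 2) \<omega>) *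
      (\<integral>\<^sup>+t. \<phi> t * ennreal (?K (R 1 \<omega>) (R (n + 2) \<omega>) t) \<partial>lborel) \<partial>M)"
  proof -
    have "(\<lambda>(u, v). \<Theta> (u, v) * (\<integral>\<^sup>+t. \<phi> t * ennreal (?K u v t) \<partial>lborel)) \<in> borel_measurable (borel \<Otimes>\<^sub>M borel)"
      by measurable
    from nn_integral_first_and_later[OF this, of n, symmetric] show ?thesis
      by (simp only: prod.case)
  qed
  finally show ?thesis .
qed

end

section \<open>Conditional expectation given two enclosing records\<close>

context iid_density
begin

abbreviation outer :: "nat \<Rightarrow> 'a \<Rightarrow> real \<times> real" where
  "outer n \<omega> \<equiv> (R 1 \<omega>, R (n + 2) \<omega>)"

abbreviation outer_algebra :: "nat \<Rightarrow> 'a measure" where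
  "outer_algebra n \<equiv> vimage_algebra (space M) (outer n) borel"

definition inner_mean :: "nat \<Rightarrow> (real \<Rightarrow> real) \<Rightarrow> real \<times> real \<Rightarrow> real" where
  "inner_mean n \<phi> p = (\<integral>t. \<phi> t * record_kernel n H h (fst p) (snd p) t \<partial>lborel)"

lemma outer_measurable[measurable]: "outer n \<in> M \<rightarrow>\<^sub>M borel"
  by (simp add: borel_prod[symmetric])

lemma outer_measurable_algebra: "outer n \<in> outer_algebra n \<rightarrow>\<^sub>M borel"
  by (rule measurable_vimage_algebra1) simp

lemma finite_measure_subalgebra_outer: "finite_measure_subalgebra M (outer_algebra n)"
proof
  show "subalgebra M (outer_algebra n)"
    using outer_measurable[of n] by (auto simp: subalgebra_def sets_vimage_algebra2 measurable_sets)
qed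

lemma inner_mean_measurable[measurable]:
  assumes [measurable]: "\<phi> \<in> borel_measurable borel"
  shows "inner_mean n \<phi> \<in> borel_measurable borel"
  unfolding inner_mean_def[abs_def] borel_prod[symmetric] by measurable

text \<open>For \<open>\<Theta> = \<phi> = 1\<close>, \<open>nn_integral_inner_records\<close> gives \<open>n - 1\<close>, the number of records summed over, as
  the mean of the total mass of the kernel. So this mass is finite almost surely.\<close>

lemma AE_integrable_kernel:
  assumes n: "2 \<le> n"
  shows "AE \<omega> in M. integrable lborel (record_kernel n H h (R 1 \<omega>) (R (n + 2) \<omega>))"
proof -
  let ?K = "\<lambda>\<omega>. \<integral>\<^sup>+t. ennreal (record_kernel n H h (R 1 \<omega>) (R (n + 2) \<omega>) t) \<partial>lborel"
  have "(\<integral>\<^sup>+\<omega>. ?K \<omega> \<partial>M) = (\<integral>\<^sup>+\<omega>. (\<Sum>j = 2..n. 1) \<partial>M)"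
    using nn_integral_inner_records[OF n, of "\<lambda>_. 1" "\<lambda>_. 1"] by simp
  also have "\<dots> = of_nat (card {2..n})"
    by (simp add: emeasure_space_1)
  finally have "(\<integral>\<^sup>+\<omega>. ?K \<omega> \<partial>M) \<noteq> \<infinity>" by simp
  then have "AE \<omega> in M. ?K \<omega> \<noteq> \<infinity>"
    by (intro nn_integral_PInf_AE) measurable
  then show ?thesis using AE_first_record_pos
  proof eventually_elim
    case (elim \<omega>)
    then show ?case
      by (intro integrableI_nonneg) (auto simp: less_top record_kernel_nonneg)
  qed
qed

text \<open>Events determined by the outer records have the form \<open>outer n \<in> B\<close>. With \<open>\<Theta>\<close> the indicator
  of \<open>B\<close>, \<open>nn_integral_inner_records\<close> says that both sides have the same integral over such an event.\<close>

lemma real_cond_exp_inner_nonneg: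
  assumes n: "2 \<le> n" and [measurable]: "\<phi> \<in> borel_measurable borel"
    and \<phi>: "\<And>t. 0 \<le> \<phi> t" "\<And>t. \<phi> t \<le> C"
  shows "AE \<omega> in M. real_cond_exp M (outer_algebra n) (\<lambda>\<omega>. \<Sum>j = 2..n. \<phi> (R j \<omega>)) \<omega> = inner_mean n \<phi> (outer n \<omega>)"
proof -
  interpret S: finite_measure_subalgebra M "outer_algebra n"
    by (rule finite_measure_subalgebra_outer)
  let ?Z = "\<lambda>\<omega>. \<Sum>j = 2..n. \<phi> (R j \<omega>)"
  have C: "0 \<le> C" using \<phi>[of 0] by simp
  have Z_nonneg: "0 \<le> ?Z \<omega>" for \<omega> by (intro sum_nonneg \<phi>)
  have Z_int: "integrable M ?Z"
    by (intro Bochner_Integration.integrable_sum integrable_const_bound[of _ C]) (auto simp: \<phi>)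
  have mean: "AE \<omega> in M. 0 \<le> inner_mean n \<phi> (outer n \<omega>) \<and> ennreal (inner_mean n \<phi> (outer n \<omega>)) =
      (\<integral>\<^sup>+t. ennreal (\<phi> t) * ennreal (record_kernel n H h (R 1 \<omega>) (R (n + 2) \<omega>) t) \<partial>lborel)"
    using AE_integrable_kernel[OF n] AE_first_record_pos
  proof eventually_elim
    case (elim \<omega>)
    let ?k = "record_kernel n H h (R 1 \<omega>) (R (n + 2) \<omega>)"
    have k: "0 \<le> ?k t" for t using elim(2) by (rule record_kernel_nonneg)
    have "integrable lborel (\<lambda>t. \<phi> t * ?k t)"
    proof (rule Bochner_Integration.integrable_bound)
      show "integrable lborel (\<lambda>t. C * ?k t)" using elim(1) by simp
      show "AE t in lborel. norm (\<phi> t * ?k t) \<le> norm (C * ?k t)"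
      proof (rule AE_I2)
        fix t
        show "norm (\<phi> t * ?k t) \<le> norm (C * ?k t)"
          using \<phi>[of t] C by (simp add: abs_mult mult_right_mono)
      qed
    qed measurable
    then have "(\<integral>\<^sup>+t. ennreal (\<phi> t * ?k t) \<partial>lborel) = ennreal (\<integral>t. \<phi> t * ?k t \<partial>lborel)"
      by (rule nn_integral_eq_integral) (intro AE_I2 mult_nonneg_nonneg \<phi> k)
    then show ?case using \<phi> k by (simp add: inner_mean_def ennreal_mult)
  qed
  have int_eq: "(\<integral>\<^sup>+\<omega>. ennreal (indicator B (outer n \<omega>) * ?Z \<omega>) \<partial>M) =
      (\<integral>\<^sup>+\<omega>. ennreal (indicator B (outer n \<omega>) * inner_mean n \<phi> (outer n \<omega>)) \<partial>M)"
    if B[measurable]: "B \<in> sets borel" for B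
  proof -
    have B': "(indicator B :: real \<times> real \<Rightarrow> ennreal) \<in> borel_measurable (borel \<Otimes>\<^sub>M borel)"
      by (simp add: borel_prod)
    have "(\<integral>\<^sup>+\<omega>. ennreal (indicator B (outer n \<omega>) * ?Z \<omega>) \<partial>M) =
        (\<integral>\<^sup>+\<omega>. indicator B (outer n \<omega>) * (\<Sum>j = 2..n. ennreal (\<phi> (R j \<omega>))) \<partial>M)"
      using Z_nonneg by (intro nn_integral_cong) (simp add: ennreal_mult ennreal_indicator sum_ennreal \<phi>)
    also have "\<dots> = (\<integral>\<^sup>+\<omega>. indicator B (outer n \<omega>) *
        (\<integral>\<^sup>+t. ennreal (\<phi> t) * ennreal (record_kernel n H h (R 1 \<omega>) (R (n + 2) \<omega>) t) \<partial>lborel) \<partial>M)"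
      by (rule nn_integral_inner_records[OF n B']) measurable
    also have "\<dots> = (\<integral>\<^sup>+\<omega>. ennreal (indicator B (outer n \<omega>) * inner_mean n \<phi> (outer n \<omega>)) \<partial>M)"
    proof (rule nn_integral_cong_AE)
      show "AE \<omega> in M. indicator B (outer n \<omega>) *
        (\<integral>\<^sup>+t. ennreal (\<phi> t) * ennreal (record_kernel n H h (R 1 \<omega>) (R (n + 2) \<omega>) t) \<partial>lborel) =
        ennreal (indicator B (outer n \<omega>) * inner_mean n \<phi> (outer n \<omega>))"
        using mean by eventually_elim (simp add: ennreal_mult ennreal_indicator)
    qed
    finally show ?thesis .
  qed
  have mean_int: "integrable M (\<lambda>\<omega>. inner_mean n \<phi> (outer n \<omega>))"
  proof (rule integrableI_nonneg)
    have "(\<integral>\<^sup>+\<omega>. ennreal (inner_mean n \<phi> (outer n \<omega>)) \<partial>M) = (\<integral>\<^sup>+\<omega>. ennreal (?Z \<omega>) \<partial>M)"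
      using int_eq[of UNIV] by simp
    also have "\<dots> < \<infinity>"
      using integrableD(2)[OF Z_int] Z_nonneg by (simp add: less_top)
    finally show "(\<integral>\<^sup>+\<omega>. ennreal (inner_mean n \<phi> (outer n \<omega>)) \<partial>M) < \<infinity>" .
    show "AE \<omega> in M. 0 \<le> inner_mean n \<phi> (outer n \<omega>)" using mean by eventually_elim simp
  qed measurable
  show ?thesis
  proof (rule S.real_cond_exp_charact)
    fix A assume "A \<in> sets (outer_algebra n)"
    then obtain B where B[measurable]: "B \<in> sets borel" and A: "A = outer n -` B \<inter> space M"
      by (auto simp: sets_vimage_algebra2)
    have "(\<integral>\<omega>\<in>A. f \<omega> \<partial>M) = (\<integral>\<omega>. indicator B (outer n \<omega>) * f \<omega> \<partial>M)" for f :: "'a \<Rightarrow> real"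
      unfolding set_lebesgue_integral_def
      by (intro Bochner_Integration.integral_cong) (auto simp: A indicator_def)
    moreover have "(\<integral>\<omega>. indicator B (outer n \<omega>) * ?Z \<omega> \<partial>M) =
        (\<integral>\<omega>. indicator B (outer n \<omega>) * inner_mean n \<phi> (outer n \<omega>) \<partial>M)"
    proof -
      have "AE \<omega> in M. 0 \<le> indicator B (outer n \<omega>) * inner_mean n \<phi> (outer n \<omega>)"
        using mean by eventually_elim simp
      then have "(\<integral>\<omega>. indicator B (outer n \<omega>) * inner_mean n \<phi> (outer n \<omega>) \<partial>M) =
          enn2real (\<integral>\<^sup>+\<omega>. ennreal (indicator B (outer n \<omega>) * inner_mean n \<phi> (outer n \<omega>)) \<partial>M)"
        by (intro integral_eq_nn_integral) measurable
      moreover have "(\<integral>\<omega>. indicator B (outer n \<omega>) * ?Z \<omega> \<partial>M) =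
          enn2real (\<integral>\<^sup>+\<omega>. ennreal (indicator B (outer n \<omega>) * ?Z \<omega>) \<partial>M)"
        by (intro integral_eq_nn_integral AE_I2 mult_nonneg_nonneg Z_nonneg) auto
      ultimately show ?thesis by (simp only: int_eq[OF B])
    qed
    ultimately show "(\<integral>\<omega>\<in>A. ?Z \<omega> \<partial>M) = (\<integral>\<omega>\<in>A. inner_mean n \<phi> (outer n \<omega>) \<partial>M)" by simp
  next
    show "(\<lambda>\<omega>. inner_mean n \<phi> (outer n \<omega>)) \<in> borel_measurable (outer_algebra n)"
      by (rule measurable_compose[OF outer_measurable_algebra]) measurable
  qed (rule Z_int mean_int)+
qed

lemma real_cond_exp_inner_bounded:
  assumes n: "2 \<le> n" and [measurable]: "\<phi> \<in> borel_measurable borel" and \<phi>: "\<And>t. \<bar>\<phi> t\<bar> \<le> C"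
  shows "AE \<omega> in M. real_cond_exp M (outer_algebra n) (\<lambda>\<omega>. \<Sum>j = 2..n. \<phi> (R j \<omega>)) \<omega> = inner_mean n \<phi> (outer n \<omega>)"
proof -
  interpret S: finite_measure_subalgebra M "outer_algebra n"
    by (rule finite_measure_subalgebra_outer)
  define p m where "p t = max 0 (\<phi> t)" and "m t = max 0 (- \<phi> t)" for t
  have [measurable]: "p \<in> borel_measurable borel" "m \<in> borel_measurable borel"
    unfolding p_def[abs_def] m_def[abs_def] by measurable
  have bounds: "0 \<le> p t" "p t \<le> C" "0 \<le> m t" "m t \<le> C" and \<phi>_eq: "\<phi> t = p t - m t" for t
    using \<phi>[of t] by (auto simp: p_def m_def)
  have Z_int: "integrable M (\<lambda>\<omega>. \<Sum>j = 2..n. p (R j \<omega>))" "integrable M (\<lambda>\<omega>. \<Sum>j = 2..n. m (R j \<omega>))"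
    by (intro Bochner_Integration.integrable_sum integrable_const_bound[of _ C]; simp add: bounds)+
  have Z_eq: "(\<lambda>\<omega>. \<Sum>j = 2..n. \<phi> (R j \<omega>)) = (\<lambda>\<omega>. (\<Sum>j = 2..n. p (R j \<omega>)) - (\<Sum>j = 2..n. m (R j \<omega>)))"
    by (simp add: \<phi>_eq sum_subtractf)
  have "AE \<omega> in M. inner_mean n \<phi> (outer n \<omega>) = inner_mean n p (outer n \<omega>) - inner_mean n m (outer n \<omega>)"
    using AE_integrable_kernel[OF n]
  proof eventually_elim
    case (elim \<omega>)
    let ?k = "record_kernel n H h (R 1 \<omega>) (R (n + 2) \<omega>)"
    have "integrable lborel (\<lambda>t. \<psi> t * ?k t)" if [measurable]: "\<psi> \<in> borel_measurable borel"
      and \<psi>: "\<And>t. 0 \<le> \<psi> t \<and> \<psi> t \<le> C" for \<psi>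
    proof (rule Bochner_Integration.integrable_bound)
      show "integrable lborel (\<lambda>t. C * ?k t)" using elim by simp
      have "norm (\<psi> t * ?k t) \<le> norm (C * ?k t)" for t
        using \<psi>[of t] by (simp add: abs_mult mult_right_mono)
      then show "AE t in lborel. norm (\<psi> t * ?k t) \<le> norm (C * ?k t)" by simp
    qed measurable
    from this[of p] this[of m] show ?case
      using bounds by (simp add: inner_mean_def \<phi>_eq left_diff_distrib)
  qed
  moreover have "AE \<omega> in M. real_cond_exp M (outer_algebra n) (\<lambda>\<omega>. \<Sum>j = 2..n. p (R j \<omega>)) \<omega> = inner_mean n p (outer n \<omega>)"
    by (rule real_cond_exp_inner_nonneg[OF n \<open>p \<in> borel_measurable borel\<close> bounds(1) bounds(2)])
  moreover have "AE \<omega> in M. real_cond_exp M (outer_algebra n) (\<lambda>\<omega>. \<Sum>j = 2..n. m (R j \<omega>)) \<omega> = inner_mean n m (outer n \<omega>)"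
    by (rule real_cond_exp_inner_nonneg[OF n \<open>m \<in> borel_measurable borel\<close> bounds(3) bounds(4)])
  moreover note S.real_cond_exp_diff[OF Z_int]
  ultimately show ?thesis unfolding Z_eq by eventually_elim (simp only:)
qed

text \<open>The sum need not be integrable. Since \<open>R\<^sub>1 \<le> R\<^sub>j \<le> R\<^sub>n\<^sub>+\<^sub>2\<close> and \<open>\<phi>\<close> is bounded on bounded sets, it is bounded on the event that both outer
  records lie in \<open>[-N, N]\<close>. This event is measurable with respect to them, so its indicator can be
  pulled out of the conditional expectation, and these events exhaust the space.\<close>

theorem real_cond_exp_inner_records:
  assumes n: "2 \<le> n" and [measurable]: "\<phi> \<in> borel_measurable borel"
    and bounded: "\<And>N :: nat. \<exists>C. \<forall>t\<in>{- real N..real N}. \<bar>\<phi> t\<bar> \<le> C"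
  shows "AE \<omega> in M. real_cond_exp M (outer_algebra n) (\<lambda>\<omega>. \<Sum>j = 2..n. \<phi> (R j \<omega>)) \<omega> = inner_mean n \<phi> (outer n \<omega>)"
proof -
  interpret S: finite_measure_subalgebra M "outer_algebra n"
    by (rule finite_measure_subalgebra_outer)
  let ?Z = "\<lambda>\<omega>. \<Sum>j = 2..n. \<phi> (R j \<omega>)"
  define B where "B N = {p :: real \<times> real. - real N \<le> fst p \<and> snd p \<le> real N}" for N
  have [measurable]: "B N \<in> sets borel" for N
  proof -
    have "closed (B N)" unfolding B_def by (intro closed_Collect_conj closed_Collect_le continuous_intros)
    then show ?thesis by simp
  qed
  have "AE \<omega> in M. indicator (B N) (outer n \<omega>) * real_cond_exp M (outer_algebra n) ?Z \<omega> =
      indicator (B N) (outer n \<omega>) * inner_mean n \<phi> (outer n \<omega>)" for N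
  proof -
    define \<psi> where "\<psi> t = indicator {- real N..real N} t * \<phi> t" for t
    have [measurable]: "\<psi> \<in> borel_measurable borel" unfolding \<psi>_def[abs_def] by measurable
    obtain C where C: "\<And>t. t \<in> {- real N..real N} \<Longrightarrow> \<bar>\<phi> t\<bar> \<le> C" using bounded[of N] by blast
    have \<psi>: "\<bar>\<psi> t\<bar> \<le> max 0 C" for t
      using C[of t] by (auto simp: \<psi>_def indicator_def)
    let ?Y = "\<lambda>\<omega>. \<Sum>j = 2..n. \<psi> (R j \<omega>)"
    let ?i = "\<lambda>\<omega>. indicator (B N) (outer n \<omega>) :: real"
    have i_meas: "?i \<in> borel_measurable (outer_algebra n)"
      by (rule measurable_compose[OF outer_measurable_algebra]) measurable
    have eq: "(\<lambda>\<omega>. ?i \<omega> * ?Z \<omega>) = (\<lambda>\<omega>. ?i \<omega> * ?Y \<omega>)"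
    proof
      fix \<omega>
      show "?i \<omega> * ?Z \<omega> = ?i \<omega> * ?Y \<omega>"
      proof (cases "outer n \<omega> \<in> B N")
        case True
        have "\<phi> (R j \<omega>) = \<psi> (R j \<omega>)" if "j \<in> {2..n}" for j
          using True that record_value_mono_le[of 1 j "path \<omega>"] record_value_mono_le[of j "n + 2" "path \<omega>"]
          by (auto simp: \<psi>_def B_def indicator_def)
        then show ?thesis by simp
      qed simp
    qed
    have "\<bar>?i \<omega> * ?Y \<omega>\<bar> \<le> real (card {2..n}) * max 0 C" for \<omega>
    proof -
      have "\<bar>?i \<omega> * ?Y \<omega>\<bar> \<le> \<bar>?Y \<omega>\<bar>" by (simp add: abs_mult indicator_def)
      also have "\<dots> \<le> (\<Sum>j = 2..n. max 0 C)" by (intro order_trans[OF sum_abs] sum_mono \<psi>)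
      finally show ?thesis by simp
    qed
    then have int: "integrable M (\<lambda>\<omega>. ?i \<omega> * ?Y \<omega>)"
      by (intro integrable_const_bound[of _ "real (card {2..n}) * max 0 C"]) auto
    have mean_eq: "?i \<omega> * inner_mean n \<psi> (outer n \<omega>) = ?i \<omega> * inner_mean n \<phi> (outer n \<omega>)" for \<omega>
    proof (cases "outer n \<omega> \<in> B N")
      case True
      have "inner_mean n \<psi> (outer n \<omega>) = inner_mean n \<phi> (outer n \<omega>)"
        unfolding inner_mean_def using True
        by (intro Bochner_Integration.integral_cong) (auto simp: \<psi>_def B_def record_kernel_def indicator_def)
      then show ?thesis by simp
    qed simp
    have "AE \<omega> in M. real_cond_exp M (outer_algebra n) (\<lambda>\<omega>. ?i \<omega> * ?Z \<omega>) \<omega> =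
        ?i \<omega> * real_cond_exp M (outer_algebra n) ?Z \<omega>"
      by (rule S.real_cond_exp_mult[OF i_meas]) (simp_all only: eq int, measurable)
    moreover have "AE \<omega> in M. real_cond_exp M (outer_algebra n) (\<lambda>\<omega>. ?i \<omega> * ?Z \<omega>) \<omega> =
        ?i \<omega> * real_cond_exp M (outer_algebra n) ?Y \<omega>"
      unfolding eq by (rule S.real_cond_exp_mult[OF i_meas _ int]) measurable
    moreover have "AE \<omega> in M. real_cond_exp M (outer_algebra n) ?Y \<omega> = inner_mean n \<psi> (outer n \<omega>)"
      by (rule real_cond_exp_inner_bounded[OF n _ \<psi>]) measurable
    ultimately show ?thesis
      by eventually_elim (metis mean_eq)
  qed
  then have "AE \<omega> in M. \<forall>N. indicator (B N) (outer n \<omega>) * real_cond_exp M (outer_algebra n) ?Z \<omega> =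
      indicator (B N) (outer n \<omega>) * inner_mean n \<phi> (outer n \<omega>)"
    unfolding AE_all_countable by (rule allI)
  then show ?thesis
  proof eventually_elim
    case (elim \<omega>)
    obtain N where "max (- R 1 \<omega>) (R (n + 2) \<omega>) \<le> real N" using real_arch_simple by blast
    then have "outer n \<omega> \<in> B N" by (auto simp: B_def)
    then show ?case using elim[rule_format, of N] by simp
  qed
qed

end

section \<open>Comparing weighted means for two hazards\<close>

lemma lborel_integral_kernel:
  fixes g \<phi> H h :: "real \<Rightarrow> real"
  assumes uv: "u < v" and g: "continuous_on {u..v} g" "\<And>t. t \<in> {u<..<v} \<Longrightarrow> \<phi> t = g t"
    and H: "continuous_on {u..v} H" "continuous_on {u..v} h" "H u \<noteq> H v"
  shows "(\<integral>t. \<phi> t * record_kernel n H h u v t \<partial>lborel) =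
    integral {u..v} (\<lambda>t. g t * (real n * (1 - ((H t - H u) / (H v - H u)) ^ (n - 1)) * h t / (H v - H u)))"
proof -
  let ?q = "\<lambda>t. g t * (real n * (1 - ((H t - H u) / (H v - H u)) ^ (n - 1)) * h t / (H v - H u))"
  have q: "continuous_on {u..v} ?q"
    using H(3) by (intro continuous_intros g(1) H(1,2)) auto
  have int: "set_integrable lborel {u..v} ?q" by (rule borel_integrable_atLeastAtMost'[OF q])
  have eq: "\<phi> t * record_kernel n H h u v t = indicator {u<..<v} t *\<^sub>R ?q t" for t
    using g(2)[of t] by (auto simp: record_kernel_def indicator_def)
  have "(\<integral>t. \<phi> t * record_kernel n H h u v t \<partial>lborel) = (LINT t:{u<..<v}|lborel. ?q t)"
    unfolding eq set_lebesgue_integral_def ..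
  also have "\<dots> = (LINT t:{u..v}|lborel. ?q t)"
  proof (rule set_integral_cong_set)
    show meas: "set_borel_measurable lborel {u..v} ?q"
      using int unfolding set_integrable_def set_borel_measurable_def by (rule borel_measurable_integrable)
    show "set_borel_measurable lborel {u<..<v} ?q"
      by (rule set_borel_measurable_subset[OF meas]) auto
    show "AE t in lborel. t \<in> {u..v} \<longleftrightarrow> t \<in> {u<..<v}"
      using AE_lborel_singleton[of u] AE_lborel_singleton[of v] by eventually_elim auto
  qed
  also have "\<dots> = integral {u..v} ?q"
    by (rule set_borel_integral_eq_integral(2)[OF int])
  finally show ?thesis .
qed

lemma I_avg_eq:
  assumes uv: "u < v" and g: "continuous_on {u..v} g"
  shows "I_avg g n u v = integral {u..v} (\<lambda>t. g t * ((t - u) / (v - u)) ^ (n - 1)) / (v - u)"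
proof -
  let ?q = "\<lambda>t. g t * ((t - u) / (v - u)) ^ (n - 1)"
  have q: "continuous_on {u..v} ?q"
    using uv by (intro continuous_intros g) auto
  have "(?q has_integral integral {u..v} ?q) (cbox u v)"
    using integrable_continuous_real[OF q] by (simp add: has_integral_integral)
  from has_integral_affinity'[OF this, of "v - u" u] uv
  have "((\<lambda>z. ?q ((v - u) * z + u)) has_integral integral {u..v} ?q / (v - u)) {0..1}"
    by (simp add: divide_inverse mult.commute)
  moreover have "?q ((v - u) * z + u) = g (u + (v - u) * z) * z ^ (n - 1)" for z
    using uv by (simp add: add.commute)
  ultimately show ?thesis
    unfolding I_avg_def by (intro integral_unique) simp
qed

lemma uniform_mean:
  assumes uv: "u < v" and g: "continuous_on {u..v} g" and n: "2 \<le> n"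
  shows "integral {u..v} (\<lambda>t. g t * (real n * (1 - ((t - u) / (v - u)) ^ (n - 1)) * 1 / (v - u))) / (real n - 1) =
    gbar g u v - (real n * I_avg g n u v - gbar g u v) / (real n - 1)"
proof -
  let ?q = "\<lambda>t. g t * ((t - u) / (v - u)) ^ (n - 1)"
  have q: "?q integrable_on {u..v}"
    using uv by (intro integrable_continuous_real continuous_intros g) auto
  have "integral {u..v} (\<lambda>t. g t * (real n * (1 - ((t - u) / (v - u)) ^ (n - 1)) * 1 / (v - u))) =
      integral {u..v} (\<lambda>t. (real n / (v - u)) * (g t - ?q t))"
    by (rule arg_cong[where f = "integral {u..v}"]) (use uv in \<open>auto simp: fun_eq_iff field_simps\<close>)
  also have "\<dots> = (real n / (v - u)) * (integral {u..v} g - integral {u..v} ?q)"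
    using integrable_continuous_real[OF g] q by (simp only: integral_mult_right integral_diff)
  also have "\<dots> = real n * (gbar g u v - I_avg g n u v)"
    unfolding I_avg_eq[OF uv g] gbar_def by (simp add: algebra_simps diff_divide_distrib)
  finally have eq: "integral {u..v} (\<lambda>t. g t * (real n * (1 - ((t - u) / (v - u)) ^ (n - 1)) * 1 / (v - u))) =
      real n * (gbar g u v - I_avg g n u v)" .
  have "a * (x - y) / (a - 1) = x - (a * y - x) / (a - 1)" if "a \<noteq> 1" for a x y :: real
    using that by (simp add: field_simps)
  then show ?thesis unfolding eq using n by simp
qed

lemma deriv_linear_minus_power:
  fixes w :: "real \<Rightarrow> real"
  assumes "(w has_real_derivative d) (at t)"
  shows "((\<lambda>t. real n * w t - w t ^ n) has_real_derivative real n * (1 - w t ^ (n - 1)) * d) (at t)"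
  using assms by (auto intro!: derivative_eq_intros simp: algebra_simps)

lemma linear_minus_power_less:
  fixes x y :: real
  assumes "0 \<le> x" "x < y" "y \<le> 1" "2 \<le> n"
  shows "real n * x - x ^ n < real n * y - y ^ n"
proof -
  have "((\<lambda>s. real n * s - s ^ n) has_real_derivative real n * (1 - s ^ (n - 1))) (at s)" for s :: real
    using deriv_linear_minus_power[OF DERIV_ident] by simp
  then obtain s where s: "x < s" "s < y"
    "(real n * y - y ^ n) - (real n * x - x ^ n) = (y - x) * (real n * (1 - s ^ (n - 1)))"
    using MVT2[OF assms(2), of "\<lambda>s. real n * s - s ^ n" "\<lambda>s. real n * (1 - s ^ (n - 1))"] by blast
  obtain m where "n = Suc (Suc m)" using assms(4) by (metis add_2_eq_Suc le_Suc_ex)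
  then have "s ^ (n - 1) < 1" using s assms power_Suc_less_one[of s m] by simp
  then have "0 < (y - x) * (real n * (1 - s ^ (n - 1)))" using assms by simp
  with s(3) show ?thesis by linarith
qed

text \<open>Equality would make the chords of \<open>H\<close> over \<open>[u, x]\<close> and \<open>[x, v]\<close> parallel, and by the mean value
  theorem \<open>h\<close> would take their common slope in both intervals.\<close>

lemma relative_hazard_neq:
  fixes H h :: "real \<Rightarrow> real"
  assumes "u < x" "x < v" and H: "\<And>t. t \<in> {u..v} \<Longrightarrow> (H has_real_derivative h t) (at t)"
    and inj: "inj_on h {u..v}" and "H u \<noteq> H v"
  shows "(H x - H u) / (H v - H u) \<noteq> (x - u) / (v - u)"
proof
  assume eq: "(H x - H u) / (H v - H u) = (x - u) / (v - u)"
  obtain s1 where s1: "u < s1" "s1 < x" "H x - H u = (x - u) * h s1"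
    using MVT2[of u x H h] assms by auto
  obtain s2 where s2: "x < s2" "s2 < v" "H v - H x = (v - x) * h s2"
    using MVT2[of x v H h] assms by auto
  have "(H x - H u) * (v - u) = (x - u) * (H v - H u)"
    using eq assms by (simp add: frac_eq_eq)
  moreover have "H v - H u = (x - u) * h s1 + (v - x) * h s2" using s1(3) s2(3) by simp
  ultimately have "(x - u) * (v - x) * (h s1 - h s2) = 0" using s1(3) by algebra
  then have "h s1 = h s2" using assms by simp
  then have "s1 = s2" using inj s1 s2 assms by (auto dest: inj_onD)
  then show False using s1 s2 by simp
qed

text \<open>With \<open>D\<close> the difference of the two distribution functions, the function
  \<open>B x = g x * D x - \<integral>\<^sub>u\<^sup>x g D'\<close> vanishes at both ends if the means agree, and its derivative is
  \<open>g' D\<close>. Rolle's theorem thus avoids any discussion of the signs of \<open>g'\<close> and \<open>D\<close>.\<close>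

lemma kernel_means_differ:
  fixes g g' H h :: "real \<Rightarrow> real"
  assumes n: "2 \<le> n" and uv: "u < v"
    and H: "\<And>t. t \<in> {u..v} \<Longrightarrow> (H has_real_derivative h t) (at t)" "continuous_on {u..v} h"
      "\<And>t. t \<in> {u..v} \<Longrightarrow> 0 < h t" "inj_on h {u..v}"
    and g: "\<And>t. t \<in> {u..v} \<Longrightarrow> (g has_real_derivative g' t) (at t)" "\<And>t. t \<in> {u..v} \<Longrightarrow> g' t \<noteq> 0"
  shows "integral {u..v} (\<lambda>t. g t * (real n * (1 - ((H t - H u) / (H v - H u)) ^ (n - 1)) * h t / (H v - H u))) \<noteq>
    integral {u..v} (\<lambda>t. g t * (real n * (1 - ((t - u) / (v - u)) ^ (n - 1)) * 1 / (v - u)))"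
    (is "integral _ (\<lambda>t. g t * ?kH t) \<noteq> integral _ (\<lambda>t. g t * ?kI t)")
proof
  assume eq: "integral {u..v} (\<lambda>t. g t * ?kH t) = integral {u..v} (\<lambda>t. g t * ?kI t)"
  have H_less: "H x < H y" if "u \<le> x" "x < y" "y \<le> v" for x y
  proof (rule DERIV_pos_imp_increasing[OF that(2)])
    fix z assume "x \<le> z" "z \<le> y"
    then show "\<exists>d. DERIV H z :> d \<and> 0 < d" using H(1,3)[of z] that by auto
  qed
  have Hc: "0 < H v - H u" using H_less[of u v] uv by simp
  have H_cont: "continuous_on {u..v} H"
    using H(1) by (intro continuous_at_imp_continuous_on ballI) (auto intro: DERIV_isCont)
  have g_cont: "continuous_on {u..v} g"
    using g(1) by (intro continuous_at_imp_continuous_on ballI) (auto intro: DERIV_isCont)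
  define w z where "w t = (H t - H u) / (H v - H u)" and "z t = (t - u) / (v - u)" for t
  define D where "D t = (real n * w t - w t ^ n) - (real n * z t - z t ^ n)" for t
  have wd: "(w has_real_derivative h t / (H v - H u)) (at t)" if "t \<in> {u..v}" for t
    unfolding w_def using DERIV_cdivide[OF DERIV_diff[OF H(1)[OF that] DERIV_const]] by simp
  have zd: "(z has_real_derivative 1 / (v - u)) (at t)" for t
    unfolding z_def using DERIV_cdivide[OF DERIV_diff[OF DERIV_ident DERIV_const]] by simp
  have D_deriv: "(D has_real_derivative ?kH t - ?kI t) (at t)" if "t \<in> {u..v}" for t
    unfolding D_def[abs_def] w_def[symmetric] z_def[symmetric]
    using DERIV_diff[OF deriv_linear_minus_power[OF wd[OF that], of n] deriv_linear_minus_power[OF zd[of t], of n]]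
    by (simp only: times_divide_eq_right)
  define q where "q t = g t * (?kH t - ?kI t)" for t
  have q_eq: "q = (\<lambda>t. g t * ?kH t - g t * ?kI t)"
    unfolding q_def by (intro ext right_diff_distrib)
  have kc: "continuous_on {u..v} (\<lambda>t. g t * ?kH t)" "continuous_on {u..v} (\<lambda>t. g t * ?kI t)"
    using Hc uv by (intro continuous_intros g_cont H_cont H(2); simp)+
  have q_cont: "continuous_on {u..v} q"
    unfolding q_eq by (intro continuous_on_diff kc)
  have q_int: "integral {u..v} q = 0"
    unfolding q_eq
    by (simp only: integral_diff integrable_continuous_real kc eq diff_self)
  define B where "B x = g x * D x - integral {u..x} q" for x
  have B_deriv: "(B has_real_derivative g' x * D x) (at x)" if "u < x" "x < v" for x
  proof -
    have "((\<lambda>x. integral {u..x} q) has_real_derivative q x) (at x)"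
      using integral_has_real_derivative[OF q_cont, of x] that by (simp add: at_within_Icc_at)
    then have "(B has_real_derivative (g' x * D x + (?kH x - ?kI x) * g x) - q x) (at x)"
      unfolding B_def[abs_def] using that g(1)[of x] D_deriv[of x]
      by (intro DERIV_diff DERIV_mult) auto
    then show ?thesis by (simp add: q_def mult.commute)
  qed
  have "continuous_on {u..v} D"
    using D_deriv by (intro continuous_at_imp_continuous_on ballI) (auto intro: DERIV_isCont)
  then have B_cont: "continuous_on {u..v} B"
    unfolding B_def[abs_def]
    by (intro continuous_intros g_cont indefinite_integral_continuous_1 integrable_continuous_real q_cont)
  have "D u = 0" "D v = 0"
    using Hc uv n by (auto simp: D_def w_def z_def)
  then have "B u = B v" by (simp add: B_def q_int)
  moreover have "B differentiable (at x)" if "u < x" "x < v" for x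
    using B_deriv[OF that] by (auto simp: real_differentiable_def)
  ultimately obtain x where x: "u < x" "x < v" "(B has_real_derivative 0) (at x)"
    using Rolle[OF uv _ B_cont] by blast
  have "g' x * D x = 0" using DERIV_unique[OF B_deriv[OF x(1,2)] x(3)] .
  then have "D x = 0" using g(2)[of x] x by simp
  moreover have "0 \<le> w x" "w x \<le> 1" "0 \<le> z x" "z x \<le> 1"
    using H_less[of u x] H_less[of x v] x by (auto simp: w_def z_def)
  ultimately have "w x = z x"
    using linear_minus_power_less[of "w x" "z x" n] linear_minus_power_less[of "z x" "w x" n] n
    by (cases "w x" "z x" rule: linorder_cases) (auto simp: D_def)
  then show False
    using relative_hazard_neq[OF x(1,2) H(1) H(4)] Hc by (auto simp: w_def z_def)
qed

text \<open>The derivative may be unbounded near 0. The tails above positive levels are computed with the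
  fundamental theorem of calculus, and the mass of \<open>(0, \<infinity>)\<close> is recovered as a limit.\<close>

lemma density_of_cdf:
  fixes \<mu> :: "real measure" and f :: "real \<Rightarrow> real"
  assumes "real_distribution \<mu>" and zero: "cdf \<mu> 0 = 0"
    and deriv: "\<And>x. 0 < x \<Longrightarrow> (cdf \<mu> has_real_derivative f x) (at x)"
    and f: "f \<in> borel_measurable borel" "\<And>x. 0 \<le> f x" "\<And>x. x \<le> 0 \<Longrightarrow> f x = 0"
  shows "\<mu> = density lborel (\<lambda>x. ennreal (f x))"
proof -
  interpret real_distribution \<mu> by fact
  note [measurable] = f(1)
  let ?\<nu> = "density lborel (\<lambda>x. ennreal (f x))"
  have tail: "emeasure \<mu> {x<..} = ennreal (1 - cdf \<mu> x)" for x
  proof -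
    have "{x<..} = UNIV - {..x}" by auto
    then show ?thesis using prob_compl[of "{..x}"] by (simp add: emeasure_eq_measure cdf_def)
  qed
  have pos: "emeasure ?\<nu> {x<..} = emeasure \<mu> {x<..}" if "0 < x" for x
  proof -
    have "emeasure ?\<nu> {x<..} = (\<integral>\<^sup>+t. ennreal (f t) * indicator {x<..} t \<partial>lborel)"
      by (simp add: emeasure_density)
    also have "\<dots> = (\<integral>\<^sup>+t. ennreal (f t) * indicator {x..} t \<partial>lborel)"
      by (rule nn_integral_cong_AE, use AE_lborel_singleton[of x] in eventually_elim) (auto simp: indicator_def)
    also have "\<dots> = ennreal (1 - cdf \<mu> x)"
      using that by (intro nn_integral_FTC_atLeast f deriv cdf_lim_at_top_prob) auto
    finally show ?thesis using tail by simp
  qed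
  have nonpos_\<nu>: "emeasure ?\<nu> {x<..} = emeasure ?\<nu> {0<..}" if "x \<le> 0" for x
  proof -
    have "ennreal (f t) * indicator {x<..} t = ennreal (f t) * indicator {0<..} t" for t
      using that f(3)[of t] by (cases "t \<le> 0") (auto simp: indicator_def)
    then show ?thesis by (simp add: emeasure_density)
  qed
  have cdf_nonpos: "cdf \<mu> x = 0" if "x \<le> 0" for x
    using cdf_nondecreasing[OF that] zero cdf_nonneg[of x] by simp
  have "emeasure ?\<nu> {0<..} = emeasure \<mu> {0<..}"
  proof -
    let ?A = "\<lambda>k. {inverse (real (Suc k))<..}"
    have A: "incseq ?A" 
    proof (rule incseq_SucI)
      fix k
      have "inverse (real (Suc (Suc k))) \<le> inverse (real (Suc k))" by (rule le_imp_inverse_le) auto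
      then show "?A k \<subseteq> ?A (Suc k)" by auto
    qed
    have U: "(\<Union>k. ?A k) = {0<..}"
    proof (intro set_eqI iffI)
      fix x :: real assume "x \<in> {0<..}"
      then show "x \<in> (\<Union>k. ?A k)" using reals_Archimedean[of x] by auto
    next
      fix x assume "x \<in> (\<Union>k. ?A k)"
      then obtain k where "inverse (real (Suc k)) < x" by auto
      moreover have "0 < inverse (real (Suc k))" by simp
      ultimately have "0 < x" by linarith
      then show "x \<in> {0<..}" by simp
    qed
    have "(\<lambda>k. emeasure \<mu> (?A k)) \<longlonglongrightarrow> emeasure \<mu> {0<..}"
      by (rule Lim_emeasure_incseq[OF _ A, unfolded U]) auto
    moreover have "(\<lambda>k. emeasure ?\<nu> (?A k)) \<longlonglongrightarrow> emeasure ?\<nu> {0<..}"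
      by (rule Lim_emeasure_incseq[OF _ A, unfolded U]) auto
    ultimately show ?thesis
      by (simp add: pos LIMSEQ_unique)
  qed
  then have "emeasure \<mu> {x<..} = emeasure ?\<nu> {x<..}" for x
    using pos[of x] nonpos_\<nu>[of x] tail[of x] tail[of 0] cdf_nonpos[of x] zero by (cases "x \<le> 0") auto
  moreover have "emeasure \<mu> {x<..} < \<infinity>" for x by (simp add: tail)
  ultimately show ?thesis by (intro measure_eqI_lessThan) auto
qed

section \<open>The characterization\<close>

lemma AE_not_in_interval:
  fixes a b :: real
  assumes "AE x in lborel. \<not> (a < x \<and> x < b)"
  shows "b \<le> a"
proof (rule ccontr)
  assume "\<not> b \<le> a"
  moreover have "{x \<in> space lborel. \<not> \<not> (a < x \<and> x < b)} = {a<..<b}" by auto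
  then have "emeasure lborel {a<..<b} = 0"
    using assms by (subst (asm) AE_iff_measurable[of "{a<..<b}"]) auto
  ultimately show False by simp
qed

context iid_density
begin

text \<open>An almost sure property of the outer records holds at some pair of values in an interval on
  which the density is positive: otherwise the event that both records fall into the interval would be null, while
  \<open>nn_integral_first_and_later\<close> expresses its probability by a positive density.\<close>

lemma outer_records_hit:
  assumes ab: "0 < a" "a < b" and pos: "\<And>x. x \<in> {a<..<b} \<Longrightarrow> 0 < f x"
    and P: "AE \<omega> in M. P (R 1 \<omega>) (R (n + 2) \<omega>)"
  shows "\<exists>u v. a < u \<and> u < v \<and> v < b \<and> P u v"
proof (rule ccontr)
  assume contra: "\<not> (\<exists>u v. a < u \<and> u < v \<and> v < b \<and> P u v)"
  let ?\<Phi> = "\<lambda>(u, v). if a < u \<and> u < v \<and> v < b then 1 else 0 :: ennreal"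
  let ?I = "\<lambda>u. \<integral>\<^sup>+v. ?\<Phi> (u, v) * ennreal (step_density n u v) \<partial>lborel"
  have \<Phi>: "?\<Phi> \<in> borel_measurable (borel \<Otimes>\<^sub>M borel)" by measurable
  have "(\<integral>\<^sup>+\<omega>. ?I (R 1 \<omega>) \<partial>M) = (\<integral>\<^sup>+\<omega>. ?\<Phi> (R 1 \<omega>, R (n + 2) \<omega>) \<partial>M)"
    by (rule nn_integral_first_and_later[OF \<Phi>, symmetric])
  also have "\<dots> = (\<integral>\<^sup>+\<omega>. 0 \<partial>M)"
    by (rule nn_integral_cong_AE, use P in eventually_elim) (use contra in auto)
  finally have "(\<integral>\<^sup>+\<omega>. ?I (R 1 \<omega>) \<partial>M) = 0" by simp
  then have "AE \<omega> in M. ?I (R 1 \<omega>) = 0"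
    by (subst (asm) nn_integral_0_iff_AE) measurable
  then have X_AE: "AE \<omega> in M. \<not> (a < X 1 \<omega> \<and> X 1 \<omega> < b)"
  proof eventually_elim
    case (elim \<omega>)
    show ?case
    proof
      assume u: "a < X 1 \<omega> \<and> X 1 \<omega> < b"
      have R1: "R 1 \<omega> = X 1 \<omega>" by (simp add: record_value_def)
      let ?u = "X 1 \<omega>"
      have "AE v in lborel. ?\<Phi> (?u, v) * ennreal (step_density n ?u v) = 0"
        using elim unfolding R1 by (subst (asm) nn_integral_0_iff_AE) auto
      then have "AE v in lborel. \<not> (?u < v \<and> v < b)"
      proof eventually_elim
        case (elim v)
        show ?case
        proof
          assume v: "?u < v \<and> v < b"
          have "H ?u < H v"
          proof (rule DERIV_pos_imp_increasing[of ?u v H])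
            fix z assume "?u \<le> z" "z \<le> v"
            then show "\<exists>d. DERIV H z :> d \<and> 0 < d"
              using H_deriv[of z] pos[of z] F_less[of z] u v ab
              by (intro exI[of _ "h z"]) (auto simp: h_def)
          qed (use v in auto)
          then have "0 < step_density n ?u v"
            using v u pos[of v] F_less[of ?u]
            by (simp add: step_density_alt zero_less_divide_iff zero_less_mult_iff zero_less_power)
          then show False using elim u v by simp
        qed
      qed
      from AE_not_in_interval[OF this] u show False by simp
    qed
  qed
  have "AE x in distr M borel (X 1). \<not> (a < x \<and> x < b)"
    using X_AE by (subst AE_distr_iff) auto
  then have "AE x in density lborel (\<lambda>x. ennreal (f x)). \<not> (a < x \<and> x < b)"
    unfolding X_law[OF order.refl] law_density .
  then have "AE x in lborel. 0 < ennreal (f x) \<longrightarrow> \<not> (a < x \<and> x < b)"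
    by (subst (asm) AE_density) auto
  then have "AE x in lborel. \<not> (a < x \<and> x < b)"
    by eventually_elim (use pos in auto)
  from AE_not_in_interval[OF this] ab show False by simp
qed

end

lemma nonzero_near:
  fixes q :: "real \<Rightarrow> real"
  assumes "continuous_on {a<..<b} q" "z \<in> {a<..<b}" "q z \<noteq> 0"
  shows "\<exists>c d. a < c \<and> c < d \<and> d < b \<and> (\<forall>x\<in>{c..d}. q x \<noteq> 0)"
proof -
  have "open ({a<..<b} \<inter> q -` (- {0}))"
    using continuous_open_preimage[OF assms(1), of "- {0}"] by auto
  moreover have "z \<in> {a<..<b} \<inter> q -` (- {0})" using assms(2,3) by simp
  ultimately obtain e where e: "0 < e" "ball z e \<subseteq> {a<..<b} \<inter> q -` (- {0})"
    by (rule openE)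
  have "{z - e / 2..z + e / 2} \<subseteq> ball z e" using e(1) by (auto simp: dist_real_def)
  then have sub: "{z - e / 2..z + e / 2} \<subseteq> {a<..<b} \<inter> q -` (- {0})" using e(2) by blast
  moreover have "z - e / 2 \<in> {z - e / 2..z + e / 2}" "z + e / 2 \<in> {z - e / 2..z + e / 2}" using e(1) by auto
  ultimately have "z - e / 2 \<in> {a<..<b}" "z + e / 2 \<in> {a<..<b}" by blast+
  with sub e(1) show ?thesis by (intro exI[of _ "z - e / 2"] exI[of _ "z + e / 2"]) auto
qed

text \<open>A nonconstant continuously differentiable function has a nonzero derivative on some interval, where it
  is injective by Rolle's theorem; it then vanishes at most once there, and being
  nonnegative it is positive on a smaller interval.\<close>

lemma nonconstant_rate_interval:
  fixes q q' :: "real \<Rightarrow> real"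
  assumes \<eta>: "0 < \<eta>" and nonconst: "\<not> q constant_on {0<..<\<eta>}" and nonneg: "\<And>x. 0 < x \<Longrightarrow> 0 \<le> q x"
    and deriv: "\<And>x. 0 < x \<Longrightarrow> (q has_real_derivative q' x) (at x)" and cont: "continuous_on {0<..} q'"
  shows "\<exists>a b. 0 < a \<and> a < b \<and> b < \<eta> \<and> inj_on q {a..b} \<and> (\<forall>x\<in>{a..b}. 0 < q x)"
proof -
  have "\<exists>z\<in>{0<..<\<eta>}. q' z \<noteq> 0"
  proof (rule ccontr)
    assume "\<not> (\<exists>z\<in>{0<..<\<eta>}. q' z \<noteq> 0)"
    then have zero: "(q has_real_derivative 0) (at x)" if "x \<in> {0<..<\<eta>}" for x
      using deriv[of x] that by simp
    have "q x = q (\<eta> / 2)" if "x \<in> {0<..<\<eta>}" for x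
      by (rule DERIV_isconst3[OF \<eta> that]) (use \<eta> zero in auto)
    then have "q constant_on {0<..<\<eta>}"
      unfolding constant_on_def by blast
    with nonconst show False ..
  qed
  then obtain z where "z \<in> {0<..<\<eta>}" "q' z \<noteq> 0" by blast
  moreover have "continuous_on {0<..<\<eta>} q'" using cont by (rule continuous_on_subset) auto
  ultimately obtain c d where cd: "0 < c" "c < d" "d < \<eta>" "\<And>x. x \<in> {c..d} \<Longrightarrow> q' x \<noteq> 0"
    using nonzero_near[of 0 \<eta> q' z] by blast
  have q_cont: "isCont q x" if "0 < x" for x using deriv[OF that] by (rule DERIV_isCont)
  have neq: "q x \<noteq> q y" if xy: "c \<le> x" "x < y" "y \<le> d" for x y
  proof
    assume "q x = q y"
    moreover have "continuous_on {x..y} q"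
      using xy(1) cd(1) by (intro continuous_at_imp_continuous_on ballI q_cont) simp
    moreover have "q differentiable (at s)" if "x < s" "s < y" for s
      using deriv[of s] that xy cd by (auto simp: real_differentiable_def)
    ultimately obtain s where s: "x < s" "s < y" "DERIV q s :> 0"
      using Rolle[OF xy(2)] by blast
    then have "q' s = 0" using DERIV_unique[OF deriv[of s] s(3)] s xy cd by simp
    then show False using cd(4)[of s] s xy by auto
  qed
  have "\<exists>p\<in>{c<..<d}. q p \<noteq> 0"
  proof -
    obtain p1 where p1: "c < p1" "p1 < d" using dense cd(2) by blast
    obtain p2 where p2: "p1 < p2" "p2 < d" using dense p1(2) by blast
    have "q p1 \<noteq> q p2" using p1 p2 by (intro neq) auto
    then have "q p1 \<noteq> 0 \<or> q p2 \<noteq> 0" by auto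
    moreover have "p1 \<in> {c<..<d}" "p2 \<in> {c<..<d}" using p1 p2 by auto
    ultimately show ?thesis by blast
  qed
  then obtain p where "p \<in> {c<..<d}" "q p \<noteq> 0" by blast
  moreover have "continuous_on {c<..<d} q"
    using cd(1) by (intro continuous_at_imp_continuous_on ballI q_cont) simp
  ultimately obtain a b where ab: "c < a" "a < b" "b < d" "\<And>x. x \<in> {a..b} \<Longrightarrow> q x \<noteq> 0"
    using nonzero_near[of c d q p] by blast
  have "inj_on q {a..b}"
  proof (rule inj_onI)
    fix x y assume "x \<in> {a..b}" "y \<in> {a..b}" "q x = q y"
    then show "x = y" using neq[of x y] neq[of y x] ab(1,3) by (cases x y rule: linorder_cases) simp_all
  qed
  moreover have "0 < q x" if "x \<in> {a..b}" for x
    using nonneg[of x] ab(4)[OF that] that ab(1) cd(1) by simp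
  ultimately show ?thesis using ab(1-3) cd(1,3) by (intro exI[of _ a] exI[of _ b]) simp
qed

theorem theorem2:
  fixes M :: "'a measure" and X :: "nat \<Rightarrow> 'a \<Rightarrow> real"
    and F g :: "real \<Rightarrow> real" and n :: nat
  assumes prob: "prob_space M"
    and indep: "prob_space.indep_vars M (\<lambda>_. borel) X {1..}"
    and cdf: "\<And>i. i \<ge> 1 \<Longrightarrow> cdf (distr M borel (X i)) = F"
    and F_zero: "F 0 = 0"
    and F_less_1: "\<And>x. x \<ge> 0 \<Longrightarrow> F x < 1"
    and F_abs_cont: "abs_continuous_on {0..} F"
    and F_diff: "F differentiable_on {0<..}" "deriv F differentiable_on {0<..}"
    and F_deriv2: "continuous_on {0<..} (deriv (deriv F))"
    and hazard: "hazard_rate F constant_on {0<..} \<or>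
      (\<exists>\<epsilon>>0. nowhere_constant_on (hazard_rate F) {0<..<\<epsilon>})"
    and g_cont: "continuous_on {0..} g"
    and g_diff: "g differentiable_on {0<..}"
    and g_deriv: "continuous_on {0<..} (deriv g)"
    and g_deriv_0: "\<exists>L. (deriv g \<longlongrightarrow> L) (at_right 0) \<and> L \<noteq> 0"
    and n: "n \<ge> 2"
  shows "(\<exists>c>0. \<forall>x\<ge>0. F x = 1 - exp (- c * x)) \<longleftrightarrow>
    (\<exists>e. cond_exp_given M
           (\<lambda>\<omega>. record_mean g n (\<lambda>i. X i \<omega>))
           (\<lambda>\<omega>. (record_value (\<lambda>i. X i \<omega>) 1, record_value (\<lambda>i. X i \<omega>) (n + 2)))
           e \<and>
         (\<forall>u v. 0 \<le> u \<and> u < v \<longrightarrow>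
            e (u, v) = gbar g u v - (real n * I_avg g n u v - gbar g u v) / (real n - 1)))"
    (is "?exponential \<longleftrightarrow> (\<exists>e. cond_exp_given M ?Z ?W e \<and> ?formula e)")
proof -
  interpret prob_space M by (rule prob)
  define \<mu> where "\<mu> = distr M borel (X 1)"
  have X_meas: "X i \<in> borel_measurable M" if "1 \<le> i" for i
    using indep that by (auto simp: indep_vars_def2)
  have real_distr: "real_distribution (distr M borel (X i))" if "1 \<le> i" for i
    using X_meas[OF that] by simp
  interpret law: real_distribution \<mu> unfolding \<mu>_def by (rule real_distr) simp
  have cdf_\<mu>: "cdf \<mu> = F" unfolding \<mu>_def by (rule cdf) simp
  have law_X: "distr M borel (X i) = \<mu>" if "1 \<le> i" for i
    using cdf[OF that] cdf_\<mu> by (intro cdf_unique real_distr that law.real_distribution_axioms) simp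
  have F_mono: "F x \<le> F y" if "x \<le> y" for x y using law.cdf_nondecreasing[OF that] by (simp add: cdf_\<mu>)
  have F_less: "F x < 1" for x
    using F_less_1[of x] F_mono[of x 0] F_zero by (cases "0 \<le> x") auto
  define f where "f x = (if x \<in> {0<..} then deriv F x else 0)" for x
  have F_deriv: "(F has_real_derivative f x) (at x)" if "0 < x" for x
    using F_diff(1) that by (simp add: f_def differentiable_on_eq_differentiable_at DERIV_deriv_iff_real_differentiable)
  have f_borel: "f \<in> borel_measurable borel"
    unfolding f_def[abs_def]
    by (intro borel_measurable_continuous_on_if differentiable_imp_continuous_on F_diff(2)) auto
  have f_nonneg: "0 \<le> f x" for x
  proof (cases "0 < x")
    case True
    then show ?thesis
      by (intro mono_on_imp_deriv_nonneg[of UNIV F _ x] F_deriv) (auto intro: mono_onI F_mono)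
  qed (simp add: f_def)
  have density: "\<mu> = density lborel (\<lambda>x. ennreal (f x))"
    using F_deriv F_zero by (intro density_of_cdf law.real_distribution_axioms f_borel f_nonneg)
      (auto simp: cdf_\<mu> f_def)
  have tail: "emeasure \<mu> {x<..} = ennreal (1 - F x)" for x
  proof -
    have "{x<..} = UNIV - {..x}" by auto
    then show ?thesis
      using law.prob_compl[of "{..x}"] cdf_\<mu> by (simp add: law.emeasure_eq_measure cdf_def fun_eq_iff)
  qed
  have F_borel: "F \<in> borel_measurable borel"
    by (rule borel_measurable_mono) (auto intro: monoI F_mono)

  \<comment> \<open>The term with index 0 may fail to be measurable. Records do not depend on it, so it is replaced by 0.\<close>
  define X' where "X' = X(0 := \<lambda>_. 0)"
  have X': "X' i = X i" if "1 \<le> i" for i using that by (auto simp: X'_def)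
  interpret iid_density M X' \<mu> F f
  proof unfold_locales
    show "X' i \<in> borel_measurable M" for i
      using X_meas[of i] by (cases "i = 0") (auto simp: X'_def)
    show "indep_vars (\<lambda>_. borel) X' {1..}"
      using indep by (subst indep_vars_cong[of _ "{1..}" _ X _ "\<lambda>_. borel"]) (auto simp: X')
    show "distr M borel (X' i) = \<mu>" if "1 \<le> i" for i using law_X that X' by simp
    show "emeasure \<mu> {x<..} \<noteq> 0" for x using F_less[of x] by (simp add: tail)
  qed (use f_borel f_nonneg density F_borel tail F_less F_deriv in \<open>auto simp: f_def\<close>)

  have R_eq: "record_value (\<lambda>i. X i \<omega>) m = R m \<omega>" if "1 \<le> m" for m \<omega>
    by (rule record_value_cong[OF _ that]) (simp add: X')
  have W_eq: "?W = outer n" using R_eq by auto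

  define \<phi> where "\<phi> t = indicator {0..} t * g t / (real n - 1)" for t
  have \<phi>_borel[measurable]: "\<phi> \<in> borel_measurable borel"
    using borel_measurable_continuous_on_indicator[OF _ g_cont] unfolding \<phi>_def[abs_def] by simp
  have \<phi>_bounded: "\<exists>C. \<forall>t\<in>{- real N..real N}. \<bar>\<phi> t\<bar> \<le> C" for N
  proof -
    have "compact (g ` {0..real N})"
      by (intro compact_continuous_image continuous_on_subset[OF g_cont]) auto
    then have "bounded (g ` {0..real N})" by (rule compact_imp_bounded)
    then obtain C where "\<forall>y\<in>g ` {0..real N}. norm y \<le> C" unfolding bounded_iff by blast
    then have C: "\<bar>g t\<bar> \<le> C" if "t \<in> {0..real N}" for t using that by simp
    have "\<bar>\<phi> t\<bar> \<le> C / (real n - 1)" if "t \<in> {- real N..real N}" for t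
    proof (cases "0 \<le> t")
      case True
      then show ?thesis using C[of t] that n by (simp add: \<phi>_def divide_right_mono)
    next
      case False
      then show ?thesis using C[of 0] n by (simp add: \<phi>_def)
    qed
    then show ?thesis by blast
  qed
  have Z_eq: "?Z = (\<lambda>\<omega>. \<Sum>j = 2..n. \<phi> (R j \<omega>))"
    unfolding record_mean_def \<phi>_def sum_divide_distrib by (intro ext sum.cong) (simp_all add: R_eq)
  have cond_exp: "AE \<omega> in M. real_cond_exp M (outer_algebra n) ?Z \<omega> = inner_mean n \<phi> (outer n \<omega>)"
    unfolding Z_eq by (rule real_cond_exp_inner_records[OF n \<phi>_borel \<phi>_bounded])

  \<comment> \<open>The conditional mean for an affine parameter, as a function on all pairs; it is the version \<open>e\<close> for exponential laws.\<close>
  define m where "m p = (\<integral>t. \<phi> t * record_kernel n (\<lambda>t. t) (\<lambda>_. 1) (fst p) (snd p) t \<partial>lborel)" for p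
  have m_borel: "m \<in> borel_measurable borel"
    unfolding m_def[abs_def] borel_prod[symmetric] by measurable
  have \<phi>_kernel: "(\<integral>t. \<phi> t * record_kernel n K k u v t \<partial>lborel) =
      integral {u..v} (\<lambda>t. g t * (real n * (1 - ((K t - K u) / (K v - K u)) ^ (n - 1)) * k t / (K v - K u))) / (real n - 1)"
    if "0 \<le> u" "u < v" "continuous_on {u..v} K" "continuous_on {u..v} k" "K u \<noteq> K v" for u v K k
  proof -
    have "(\<integral>t. \<phi> t * record_kernel n K k u v t \<partial>lborel) =
        (\<integral>t. (indicator {0..} t * g t) * record_kernel n K k u v t \<partial>lborel) / (real n - 1)"
      unfolding \<phi>_def by simp
    also have "\<dots> = integral {u..v} (\<lambda>t. g t * (real n * (1 - ((K t - K u) / (K v - K u)) ^ (n - 1)) * k t / (K v - K u))) / (real n - 1)"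
      using that by (subst lborel_integral_kernel[of u v g]) (auto intro: continuous_on_subset[OF g_cont])
    finally show ?thesis .
  qed
  have m_formula: "m (u, v) = gbar g u v - (real n * I_avg g n u v - gbar g u v) / (real n - 1)"
    if "0 \<le> u" "u < v" for u v
  proof -
    have "continuous_on {u..v} g" using that by (intro continuous_on_subset[OF g_cont]) auto
    from uniform_mean[OF that(2) this n] that show ?thesis
      by (simp add: m_def \<phi>_kernel)
  qed

  show ?thesis
  proof
    assume ?exponential
    then obtain c where c: "0 < c" "\<And>x. 0 \<le> x \<Longrightarrow> F x = 1 - exp (- c * x)" by blast
    have H_lin: "H x = c * x" if "0 \<le> x" for x
      using c(2)[OF that] by (simp add: H_def cum_hazard_def)
    have h_const: "h x = c" if "0 < x" for x
    proof -
      have "(H has_real_derivative c) (at x)"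
      proof (rule has_field_derivative_transform_within_open)
        show "((\<lambda>x. c * x) has_real_derivative c) (at x)" by (auto intro!: derivative_eq_intros)
        show "x \<in> {0<..}" using that by simp
      qed (auto simp: H_lin)
      then show ?thesis using DERIV_unique H_deriv[OF that] by blast
    qed
    have kernel: "record_kernel n H h u v t = record_kernel n (\<lambda>t. t) (\<lambda>_. 1) u v t" if "0 < u" for u v t
    proof (cases "u < t \<and> t < v")
      case True
      have "(c * t - c * u) / (c * v - c * u) = (t - u) / (v - u)"
        using c(1) by (simp add: right_diff_distrib[symmetric])
      moreover have "x * c / (c * v - c * u) = x / (v - u)" for x
        using c(1) by (simp add: right_diff_distrib[symmetric])
      ultimately show ?thesis using True that by (simp add: record_kernel_def H_lin h_const)
    qed (auto simp: record_kernel_def)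
    have "AE \<omega> in M. real_cond_exp M (outer_algebra n) ?Z \<omega> = m (outer n \<omega>)"
      using cond_exp AE_first_record_pos by eventually_elim (simp add: inner_mean_def m_def kernel)
    then have "cond_exp_given M ?Z ?W m"
      unfolding cond_exp_given_def W_eq using m_borel by simp
    then show "\<exists>e. cond_exp_given M ?Z ?W e \<and> ?formula e" using m_formula by blast
  next
    assume "\<exists>e. cond_exp_given M ?Z ?W e \<and> ?formula e"
    then obtain e where e: "cond_exp_given M ?Z ?W e" "?formula e" by blast
    have rate: "hazard_rate F x = h x" if "0 < x" for x
      using H_deriv[OF that] by (simp add: hazard_rate_def H_def DERIV_imp_deriv)
    from hazard show ?exponential
    proof
      assume "hazard_rate F constant_on {0<..}"
      then obtain c where "\<And>x. 0 < x \<Longrightarrow> hazard_rate F x = c" by (auto simp: constant_on_def)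
      then have c: "h x = c" if "0 < x" for x using rate that by simp
      have F_cont: "continuous_on {0..} F"
        unfolding continuous_on_eq_continuous_within
      proof
        fix x :: real assume "x \<in> {0..}"
        then consider "x = 0" | "0 < x" by force
        then show "continuous (at x within {0..}) F"
        proof cases
          case 1
          then show ?thesis using law.cdf_is_right_cont[of 0] by (simp add: cdf_\<mu> at_within_Ici_at_right)
        next
          case 2
          then show ?thesis using F_deriv by (blast intro: continuous_at_imp_continuous_at_within DERIV_isCont)
        qed
      qed
      have H_cont: "continuous_on {0..x} H" for x
        unfolding H_def cum_hazard_def[abs_def] using F_less
        by (intro continuous_intros continuous_on_subset[OF F_cont]) (auto simp: less_le)
      have F_eq: "F x = 1 - exp (- c * x)" if "0 \<le> x" for x
      proof (cases "x = 0")
        case False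
        then have x: "0 < x" using that by simp
        have "H differentiable (at z)" if "0 < z" "z < x" for z
          using H_deriv[OF that(1)] by (auto simp: real_differentiable_def)
        then obtain l z where z: "0 < z" "DERIV H z :> l" "H x - H 0 = (x - 0) * l"
          using MVT[OF x H_cont] by blast
        have "l = c" using DERIV_unique[OF z(2) H_deriv[OF z(1)]] c[OF z(1)] by simp
        then have "ln (1 - F x) = - c * x"
          using z(3) F_zero by (simp add: H_def cum_hazard_def mult.commute)
        then have "exp (- c * x) = exp (ln (1 - F x))" by simp
        also have "\<dots> = 1 - F x" using F_less[of x] by simp
        finally show ?thesis by simp
      qed (simp add: F_zero)
      have "0 < c"
      proof (rule ccontr)
        assume "\<not> 0 < c"
        then have "F x \<le> 0" if "0 \<le> x" for x
          using F_eq[OF that] that by (simp add: mult_nonpos_nonneg)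
        then have "eventually (\<lambda>x. F x \<le> 0) at_top"
          using eventually_ge_at_top[of 0] by (rule eventually_mono[rotated])
        then have "(1::real) \<le> 0"
          using law.cdf_lim_at_top_prob by (intro tendsto_upperbound[of F]) (auto simp: cdf_\<mu>)
        then show False by simp
      qed
      then show ?thesis using F_eq by blast
    next
      assume "\<exists>\<epsilon>>0. nowhere_constant_on (hazard_rate F) {0<..<\<epsilon>}"
      then obtain \<epsilon> where \<epsilon>: "0 < \<epsilon>" "nowhere_constant_on (hazard_rate F) {0<..<\<epsilon>}" by blast
      obtain L where L: "(deriv g \<longlongrightarrow> L) (at_right 0)" "L \<noteq> 0" using g_deriv_0 by blast
      then obtain \<delta> where \<delta>: "0 < \<delta>" "\<And>x. 0 < x \<Longrightarrow> x < \<delta> \<Longrightarrow> deriv g x \<noteq> 0"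
        using tendsto_imp_eventually_ne[OF L] by (auto simp: eventually_at_right_field)
      define \<eta> where "\<eta> = min \<epsilon> \<delta>"
      have \<eta>: "0 < \<eta>" using \<epsilon> \<delta> by (simp add: \<eta>_def)
      have "\<not> hazard_rate F constant_on {0<..<\<eta>}"
      proof -
        have "{0<..<\<eta>} \<subseteq> {0<..<\<epsilon>}" by (auto simp: \<eta>_def)
        then show ?thesis using \<epsilon>(2) \<eta> unfolding nowhere_constant_on_def by blast
      qed
      then have nonconst: "\<not> h constant_on {0<..<\<eta>}"
        using rate by (simp add: constant_on_def)
      define h' where "h' x = (deriv (deriv F) x * (1 - F x) + deriv F x * deriv F x) / ((1 - F x) * (1 - F x))" for x
      have F_cont: "continuous_on {0<..} F" "continuous_on {0<..} (deriv F)"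
        using F_diff by (auto intro: differentiable_imp_continuous_on)
      have h'_cont: "continuous_on {0<..} h'"
        unfolding h'_def[abs_def] using F_less
        by (intro continuous_intros F_cont F_deriv2) (auto simp: less_le)
      have h_deriv: "(h has_real_derivative h' x) (at x)" if "0 < x" for x
      proof (rule has_field_derivative_transform_within_open)
        have "(deriv F has_real_derivative deriv (deriv F) x) (at x)"
          using F_diff(2) that by (simp add: differentiable_on_eq_differentiable_at DERIV_deriv_iff_real_differentiable)
        moreover have "(F has_real_derivative deriv F x) (at x)" using F_deriv[OF that] that by (simp add: f_def)
        ultimately show "((\<lambda>x. deriv F x / (1 - F x)) has_real_derivative h' x) (at x)"
          unfolding h'_def using F_less[of x]
          by (auto intro!: derivative_eq_intros)
        show "x \<in> {0<..}" using that by simp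
      qed (auto simp: h_def f_def)
      obtain a b where ab: "0 < a" "a < b" "b < \<eta>" "inj_on h {a..b}" "\<And>x. x \<in> {a..b} \<Longrightarrow> 0 < h x"
        using nonconstant_rate_interval[OF \<eta> nonconst h_nonneg h_deriv h'_cont] by blast
      have "AE \<omega> in M. real_cond_exp M (outer_algebra n) ?Z \<omega> = e (outer n \<omega>)"
        using e(1) unfolding cond_exp_given_def W_eq by blast
      with cond_exp have "AE \<omega> in M. inner_mean n \<phi> (R 1 \<omega>, R (n + 2) \<omega>) = e (R 1 \<omega>, R (n + 2) \<omega>)"
        by eventually_elim simp
      moreover have "0 < f x" if "x \<in> {a<..<b}" for x
        using ab(5)[of x] that F_less[of x] by (simp add: h_def zero_less_divide_iff)
      ultimately have "\<exists>u v. a < u \<and> u < v \<and> v < b \<and> inner_mean n \<phi> (u, v) = e (u, v)"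
        by (intro outer_records_hit[OF ab(1,2), where n = n])
      then obtain u v where uv: "a < u" "u < v" "v < b" "inner_mean n \<phi> (u, v) = e (u, v)" by blast
      have sub: "{u..v} \<subseteq> {a..b}" using uv by auto
      have pos: "0 < x" if "x \<in> {u..v}" for x using uv ab(1) that by auto
      have g_der: "(g has_real_derivative deriv g t) (at t)" if "t \<in> {u..v}" for t
        using g_diff pos[OF that] by (simp add: differentiable_on_eq_differentiable_at DERIV_deriv_iff_real_differentiable)
      have g_nz: "deriv g t \<noteq> 0" if "t \<in> {u..v}" for t
        using \<delta>(2)[OF pos[OF that]] that uv(3) ab(3) by (simp add: \<eta>_def)
      have h_cont: "continuous_on {u..v} h"
        by (intro continuous_at_imp_continuous_on ballI) (rule DERIV_isCont, rule h_deriv, erule pos)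
      have H_cont: "continuous_on {u..v} H"
        by (intro continuous_at_imp_continuous_on ballI) (rule DERIV_isCont, rule H_deriv, erule pos)
      have H_less: "H u < H v"
      proof (rule DERIV_pos_imp_increasing[OF uv(2)])
        fix z assume "u \<le> z" "z \<le> v"
        then show "\<exists>d. DERIV H z :> d \<and> 0 < d"
          using H_deriv[of z] ab(5)[of z] uv(1,3) ab(1) by (intro exI[of _ "h z"]) simp
      qed
      have "inner_mean n \<phi> (u, v) = m (u, v)"
        using uv e(2) m_formula[of u v] ab(1) by simp
      moreover have "inner_mean n \<phi> (u, v) \<noteq> m (u, v)"
      proof -
        let ?A = "integral {u..v} (\<lambda>t. g t * (real n * (1 - ((H t - H u) / (H v - H u)) ^ (n - 1)) * h t / (H v - H u)))"
        let ?B = "integral {u..v} (\<lambda>t. g t * (real n * (1 - ((t - u) / (v - u)) ^ (n - 1)) * 1 / (v - u)))"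
        have "?A \<noteq> ?B"
        proof (rule kernel_means_differ[OF n uv(2) _ h_cont _ _ g_der g_nz])
          show "(H has_real_derivative h t) (at t)" if "t \<in> {u..v}" for t using H_deriv[OF pos[OF that]] .
          show "0 < h t" if "t \<in> {u..v}" for t using ab(5)[of t] sub that by blast
          show "inj_on h {u..v}" using ab(4) sub by (rule inj_on_subset)
        qed
        moreover have "inner_mean n \<phi> (u, v) = ?A / (real n - 1)"
          unfolding inner_mean_def fst_conv snd_conv
          using uv ab(1) H_less by (intro \<phi>_kernel H_cont h_cont) auto
        moreover have "m (u, v) = ?B / (real n - 1)"
          unfolding m_def fst_conv snd_conv
          using uv ab(1) by (intro \<phi>_kernel) auto
        moreover have "real n - 1 \<noteq> 0" using n by simp
        ultimately show ?thesis by (simp only: divide_cancel_right simp_thms)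
      qed
      ultimately show ?thesis by contradiction
    qed
  qed
qed

end
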